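(* Let $v_0(0)=I_m$ ($m=2p$). Then the matrix functions $$\varphi(z)=-\frac i2D+\Psi_1(0)^*(\gamma-zI_n)^{-1}\Psi_2,\qquad \widehat\varphi(z)=\frac i2|D|+\widehat\Psi_1(0)^*(\widehat\gamma-zI_n)^{-1}\widehat\Psi_2,$$ where $$\gamma:=\alpha-i\Psi_2\Lambda_2(0)^*,\quad \Psi_1(0)=\Lambda_1(0)+\tfrac12\Lambda_2(0)D,\quad \Psi_2=\Lambda_1(0)-\tfrac12\Lambda_2(0)D\equiv\Lambda_1(x)-\tfrac12\Lambda_2(x)D,$$ $$\widehat\gamma:=\alpha-i\widehat\Psi_2\Lambda_2(0)^*,\quad \widehat\Psi_1(0)=\Lambda_1(0)-\tfrac12\Lambda_2(0)|D|,\quad \widehat\Psi_2=\Lambda_1(0)+\tfrac12\Lambda_2(0)|D|,\quad |D|=\mathrm{diag}\{|d_1|,|d_2|,\dots,|d_p|\},$$ are Weyl functions of the canonical system determined by $\alpha$ and $\Lambda(0)$. If $D<0$, then the Weyl functions $\varphi(z)$ and $\widehat\varphi(z)$ coincide and, moreover, the Weyl function is unique. The matrices $\gamma$ and $\widehat\gamma$ satisfy the matrix identities $$\gamma-\gamma^*=i\Lambda_2(0)D\Lambda_2(0)^*,\qquad \widehat\gamma^*-\widehat\gamma=i\big(\widehat\Psi_2-\widehat\Psi_1(0)\big)|D|^{-1}\big(\widehat\Psi_2-\widehat\Psi_1(0)\big)^*,$$ that is, for $D<0$ we obtain $\sigma(\gamma)\cap\mathbb C_+=\emptyset$, and $\varphi$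 does not have singularities in $\mathbb C_+$.
   Context: Notation: $J=\begin{bmatrix}0&I_p\\ I_p&0\end{bmatrix}$, $\mathbb C_+$ is the open upper half-plane, $\sigma$ denotes spectrum, $D=D^*=\mathrm{diag}\{d_1,\dots,d_p\}$ is a fixed diagonal matrix with $\det D\ne0$, and $H_0=\begin{bmatrix}D/2\\ I_p\end{bmatrix}[\,D/2\ \ I_p\,]$. Canonical system determined by $\alpha$ and $\Lambda(0)$: let $n>0$ be an integer, $\alpha$ an $n\times n$ matrix, and $\Lambda(0)=[\Lambda_1(0)\ \ \Lambda_2(0)]$ with $n\times p$ blocks, such that $\alpha-\alpha^*=i\Lambda(0)J\Lambda(0)^*$. Define the $n\times m$ matrix function $\Lambda(x)=[\Lambda_1(x)\ \ \Lambda_2(x)]$ and the $n\times n$ matrix function $\Sigma(x)$ on $x\ge0$ by $$\Lambda'=-i\alpha\Lambda JH_0,\quad \Lambda(0)=[\Lambda_1(0)\ \ \Lambda_2(0)];\qquad \Sigma'=\Psi_1\Psi_1^*,\quad \Sigma(0)=I_n,\quad \Psi_1(x)=\Lambda(x)\begin{bmatrix}I_p\\ D/2\end{bmatrix}.$$ (So $\Sigma(x)\ge I_n$ is invertible.) Let $v_0$ satisfy $v_0'=-q_0v_0$, $v_0(0)Jv_0(0)^*=J$, where $$q_0(x)=J\Lambda(x)^*\Sigma(x)^{-1}\Lambda(x)JH_0-JH_0J\Lambda(x)^*\Sigma(x)^{-1}\Lambda(x).$$ The canonical system determined by $\alpha$ and $\Lambda(0)$ is $$\frac{d}{dx}w(x,z)=izJH(x)w(x,z),\qquad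 H(x)=v_0(x)^*H_0v_0(x),\qquad x\ge0.$$ Weyl function: let $w$ be the fundamental solution normalized by $w(0,z)=I_{2p}$. A Weyl function of the canonical system on the semi-axis $x\ge0$ is a $p\times p$ holomorphic matrix function $\varphi(z)$ which satisfies the condition $$\int_0^\infty[\,I_p\ \ i\varphi(z)^*\,]\,w(x,z)^*H(x)w(x,z)\begin{bmatrix}I_p\\ -i\varphi(z)\end{bmatrix}dx<\infty,\qquad z\in\mathbb C_+.$$
   Formalization: For D not negative, φ can have poles in C₊ (p=n=1, D=1, α=0, Λ(0)=[0 1] gives γ=i/2), so φ is claimed holomorphic with finite integral only at z in C₊ outside σ(γ); for D<0 and for φ̂ the claim holds on all of C₊, and uniqueness also covers functions with a discrete exceptional set. *)

theory Defs
  imports "HOL-Analysis.Analysis"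
begin

text \<open>
  An \<open>r \<times> c\<close> complex matrix is \<open>complex^'c^'r\<close>; the index type \<open>'p + 'p\<close> carries the
  \<open>p + p\<close> block structure (so \<open>m = 2p\<close>). On these types \<open>*\<close> and \<open>1\<close> are componentwise; the
  matrix product is \<open>**\<close>, \<open>mat c\<close> is \<open>c\<close> times the identity, and \<open>mat c ** A\<close> is \<open>c A\<close>.
\<close>

definition cadjoint :: "complex^'c^'r \<Rightarrow> complex^'r^'c"  (\<open>_\<^sup>\<dagger>\<close> [1000] 999) where
  "A\<^sup>\<dagger> = (\<chi> i j. cnj (A $ j $ i))"

definition matrix_spectrum :: "complex^'n^'n \<Rightarrow> complex set" where
  "matrix_spectrum A = {z. \<not> invertible (A - mat z)}"

definition negative_definite :: "complex^'n^'n \<Rightarrow> bool" where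
  "negative_definite A \<longleftrightarrow>
     A\<^sup>\<dagger> = A \<and> (\<forall>x. x \<noteq> 0 \<longrightarrow> Re (\<Sum>i\<in>UNIV. cnj (x $ i) * (A *v x) $ i) < 0)"

definition diag_matrix :: "('p \<Rightarrow> real) \<Rightarrow> complex^'p^'p" where
  "diag_matrix d = (\<chi> i j. if i = j then complex_of_real (d i) else 0)"

definition upper_half_plane :: "complex set"  (\<open>\<complex>\<^sub>+\<close>) where
  "\<complex>\<^sub>+ = {z. Im z > 0}"


subsection \<open>Block matrices\<close>

definition beside :: "complex^'p^'n \<Rightarrow> complex^'q^'n \<Rightarrow> complex^('p::finite + 'q::finite)^'n" where
  "beside A B = (\<chi> i j. case j of Inl k \<Rightarrow> A $ i $ k | Inr k \<Rightarrow> B $ i $ k)"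

definition above :: "complex^'n^'p \<Rightarrow> complex^'n^'q \<Rightarrow> complex^'n^('p::finite + 'q::finite)" where
  "above A B = (\<chi> i. case i of Inl k \<Rightarrow> A $ k | Inr k \<Rightarrow> B $ k)"

definition left_block :: "complex^('p::finite + 'q::finite)^'n \<Rightarrow> complex^'p^'n" where
  "left_block A = (\<chi> i k. A $ i $ Inl k)"

definition right_block :: "complex^('p::finite + 'q::finite)^'n \<Rightarrow> complex^'q^'n" where
  "right_block A = (\<chi> i k. A $ i $ Inr k)"


subsection \<open>The canonical system\<close>

definition J :: "complex^('p + 'p)^('p::finite + 'p)" where
  "J = above (beside 0 (mat 1)) (beside (mat 1) 0)"

definition H0 :: "complex^'p^'p \<Rightarrow> complex^('p + 'p)^('p::finite + 'p)" where
  "H0 D = above ((1/2) *\<^sub>R D) (mat 1) ** beside ((1/2) *\<^sub>R D) (mat 1)"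

text \<open>Below, \<open>L\<close> stands for a value \<open>\<Lambda>(x) = [\<Lambda>\<^sub>1(x) \<Lambda>\<^sub>2(x)]\<close> and \<open>S\<close> for a value \<open>\<Sigma>(x)\<close>.\<close>

definition Psi1 :: "complex^'p^'p \<Rightarrow> complex^('p::finite + 'p)^'n \<Rightarrow> complex^'p^'n" where
  "Psi1 D L = L ** above (mat 1) ((1/2) *\<^sub>R D)"

definition q0 :: "complex^'p^'p \<Rightarrow> complex^('p::finite + 'p)^'n \<Rightarrow> complex^'n^'n
    \<Rightarrow> complex^('p + 'p)^('p + 'p)" where
  "q0 D L S = J ** L\<^sup>\<dagger> ** matrix_inv S ** L ** J ** H0 D
            - J ** H0 D ** J ** L\<^sup>\<dagger> ** matrix_inv S ** L"

definition fundamental_solution :: "(real \<Rightarrow> complex^('p + 'p)^('p + 'p))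
    \<Rightarrow> (real \<Rightarrow> complex \<Rightarrow> complex^('p + 'p)^('p::finite + 'p)) \<Rightarrow> bool" where
  "fundamental_solution H w \<longleftrightarrow>
     (\<forall>z. w 0 z = mat 1 \<and>
        (\<forall>x\<ge>0. ((\<lambda>x. w x z) has_vector_derivative mat (\<i> * z) ** J ** H x ** w x z)
                  (at x within {0..})))"

text \<open>
  A Weyl function may have isolated singularities in the upper half-plane: for the explicit
  \<open>\<phi>\<close> below they do occur when \<open>D\<close> is not negative. They are collected in the
  discrete set \<open>S\<close>; \<open>S = {}\<close> is the case of a function holomorphic in all of \<open>\<complex>\<^sub>+\<close>.
  The integrand is continuous with positive semidefinite values, so that its integral is finite
  iff it is absolutely integrable.
\<close>

definition weyl_function :: "(real \<Rightarrow> complex^('p + 'p)^('p + 'p))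
    \<Rightarrow> (real \<Rightarrow> complex \<Rightarrow> complex^('p + 'p)^('p::finite + 'p))
    \<Rightarrow> complex set \<Rightarrow> (complex \<Rightarrow> complex^'p^'p) \<Rightarrow> bool" where
  "weyl_function H w S \<phi> \<longleftrightarrow>
     S sparse_in \<complex>\<^sub>+ \<and>
     (\<forall>i j. (\<lambda>z. \<phi> z $ i $ j) holomorphic_on (\<complex>\<^sub>+ - S)) \<and>
     (\<forall>z \<in> \<complex>\<^sub>+ - S.
        (\<lambda>x. beside (mat 1) (mat \<i> ** (\<phi> z)\<^sup>\<dagger>) ** (w x z)\<^sup>\<dagger> ** H x ** w x z
              ** above (mat 1) (mat (- \<i>) ** \<phi> z)) absolutely_integrable_on {0..})"


subsection \<open>The explicit Weyl functions\<close>

text \<open>Here \<open>L\<close> stands for \<open>\<Lambda>(0)\<close>, and \<open>E\<close> for \<open>|D|\<close>.\<close>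

definition Psi2 :: "complex^'p^'p \<Rightarrow> complex^('p::finite + 'p)^'n \<Rightarrow> complex^'p^'n" where
  "Psi2 D L = left_block L - (1/2) *\<^sub>R (right_block L ** D)"

definition gam :: "complex^'p^'p \<Rightarrow> complex^'n^'n \<Rightarrow> complex^('p::finite + 'p)^'n
    \<Rightarrow> complex^'n^'n" where
  "gam D \<alpha> L = \<alpha> - mat \<i> ** Psi2 D L ** (right_block L)\<^sup>\<dagger>"

definition phi :: "complex^'p^'p \<Rightarrow> complex^'n^'n \<Rightarrow> complex^('p::finite + 'p)^'n
    \<Rightarrow> complex \<Rightarrow> complex^'p^'p" where
  "phi D \<alpha> L z = mat (- \<i> / 2) ** D
     + (Psi1 D L)\<^sup>\<dagger> ** matrix_inv (gam D \<alpha> L - mat z) ** Psi2 D L"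

definition Psi1_hat :: "complex^'p^'p \<Rightarrow> complex^('p::finite + 'p)^'n \<Rightarrow> complex^'p^'n" where
  "Psi1_hat E L = left_block L - (1/2) *\<^sub>R (right_block L ** E)"

definition Psi2_hat :: "complex^'p^'p \<Rightarrow> complex^('p::finite + 'p)^'n \<Rightarrow> complex^'p^'n" where
  "Psi2_hat E L = left_block L + (1/2) *\<^sub>R (right_block L ** E)"

definition gam_hat :: "complex^'p^'p \<Rightarrow> complex^'n^'n \<Rightarrow> complex^('p::finite + 'p)^'n
    \<Rightarrow> complex^'n^'n" where
  "gam_hat E \<alpha> L = \<alpha> - mat \<i> ** Psi2_hat E L ** (right_block L)\<^sup>\<dagger>"

definition phi_hat :: "complex^'p^'p \<Rightarrow> complex^'n^'n \<Rightarrow> complex^('p::finite + 'p)^'n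
    \<Rightarrow> complex \<Rightarrow> complex^'p^'p" where
  "phi_hat E \<alpha> L z = mat (\<i> / 2) ** E
     + (Psi1_hat E L)\<^sup>\<dagger> ** matrix_inv (gam_hat E \<alpha> L - mat z) ** Psi2_hat E L"

end

theory Submission
  imports Defs
begin

text \<open>
  Both explicit functions are instances of one formula. For a diagonal \<open>G\<close> with entries \<open>\<plusminus> d i\<close>,
  \<open>phi_hat G\<close> gives the second function when \<open>G = |D|\<close> and the first when \<open>G = - D\<close>
  (\<open>phi_eq_phi_hat\<close>); for \<open>D < 0\<close> these are the same \<open>G\<close>. What matters is \<open>D + G \<ge> 0\<close>.

  Along a solution \<open>Y\<close> of the canonical system at a point \<open>z\<close>, the derivative of the indefinite form
  \<open>Y \<bullet> (J ** Y)\<close> is \<open>- 2 * Im z\<close> times the integrand in the definition of a Weyl function, in trace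
  norm (\<open>energy_identity\<close>). In the upper half-plane it is therefore enough to exhibit a solution with
  initial value \<open>above 1 (- \<i> \<phi>)\<close> for which the form is bounded below.

  Such solutions come from the system with constant Hamiltonian \<open>H0 D\<close>, which has the bounded
  solutions \<open>F = above 1 (G / 2) ** exp (\<i> z x (D + G) / 2) ** c\<close>, by the Darboux transformation that
  \<open>\<alpha>\<close>, \<open>\<Lambda>\<close> and \<open>\<Sigma>\<close> define (\<open>transformed_solution\<close>). This transformation adds to the form of \<open>F\<close> the
  product of \<open>2 * Im z\<close> and a value of the positive form of \<open>\<Sigma>\<close> (\<open>transformed_energy\<close>), so the lower
  bound persists. Solving for the constant \<open>c\<close> that normalizes the initial value gives exactly the
  formula for
  \<open>phi_hat G\<close>, and the only obstruction is the spectrum of \<open>gam_hat G\<close> (\<open>weyl_integrable_explicit\<close>).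

  The skew part of \<open>gam_hat G\<close> is a congruence transform of \<open>G\<close> (\<open>gam_hat_identity\<close>), so its spectrum
  avoids the upper half-plane when \<open>G \<ge> 0\<close>, and is finite in any case.

  If \<open>D < 0\<close>, the form is bounded below by a negative multiple of the energy density
  (\<open>energy_ge_density\<close>). Two distinct values of Weyl functions at the same \<open>z\<close> would give a nonzero
  solution of finite energy whose form is \<open>0\<close> at the start and negative afterwards; its
  energy density would then stay away from \<open>0\<close> on a half-line (\<open>weyl_matrix_unique\<close>).
\<close>


section \<open>Complex matrix algebra\<close>

text \<open>The product \<open>mat c ** A\<close> does not commute past other factors syntactically. With \<open>\<odot>\<close> all
  scalars collect in front, so that an identity between products of matrices becomes one between
  linear combinations of words, which rewriting with associativity decides.\<close>

definition cscale :: "complex \<Rightarrow> complex^'c^'r \<Rightarrow> complex^'c^'r"  (infixr \<open>\<odot>\<close> 75) where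
  "c \<odot> A = (\<chi> i j. c * A $ i $ j)"

lemma cscale_nth [simp]: "(c \<odot> A) $ i $ j = c * A $ i $ j"
  by (simp add: cscale_def)

lemma mat_mult_eq_cscale: "mat c ** A = c \<odot> A"
  by (simp add: vec_eq_iff matrix_matrix_mult_def mat_def if_distrib[of "\<lambda>x. x * _"] cong: if_cong)

lemma scaleR_eq_cscale: "r *\<^sub>R A = complex_of_real r \<odot> A"
  by (simp add: vec_eq_iff scaleR_conv_of_real[symmetric])

lemma cscale_mult_left [simp]: "(c \<odot> A) ** B = c \<odot> (A ** B)"
  by (simp add: vec_eq_iff matrix_matrix_mult_def sum_distrib_left mult_ac)

lemma cscale_mult_right [simp]: "A ** (c \<odot> B) = c \<odot> (A ** B)"
  by (simp add: vec_eq_iff matrix_matrix_mult_def sum_distrib_left mult_ac)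

lemma cscale_cscale [simp]: "a \<odot> b \<odot> A = (a * b) \<odot> A"
  by (simp add: vec_eq_iff)

lemma cscale_one [simp]: "1 \<odot> A = A"
  by (simp add: vec_eq_iff)

lemma cscale_zero [simp]: "0 \<odot> A = 0" "c \<odot> 0 = 0"
  by (simp_all add: vec_eq_iff)

lemma cscale_minus_left: "(- c) \<odot> A = - (c \<odot> A)"
  and cscale_minus_right: "c \<odot> (- A) = - (c \<odot> A)"
  by (simp_all add: vec_eq_iff)

lemma cscale_add: "c \<odot> (A + B) = c \<odot> A + c \<odot> B"
  and cscale_diff: "c \<odot> (A - B) = c \<odot> A - c \<odot> B"
  by (simp_all add: vec_eq_iff algebra_simps)

lemma cscale_add_left: "(a + b) \<odot> A = a \<odot> A + b \<odot> A"
  by (simp add: vec_eq_iff algebra_simps)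

lemma matrix_mult_add_left: "(A + B) ** C = A ** C + B ** (C :: complex^'c^'k)"
  and matrix_mult_diff_left: "(A - B) ** C = A ** C - B ** (C :: complex^'c^'k)"
  and matrix_mult_diff_right: "C' ** (A - B) = C' ** A - C' ** (B :: complex^'k^'r)"
  and matrix_mult_minus_left: "(- A) ** C = - (A ** (C :: complex^'c^'k))"
  and matrix_mult_minus_right: "C' ** (- A) = - (C' ** (A :: complex^'k^'r))"
  by (simp_all add: vec_eq_iff matrix_matrix_mult_def algebra_simps sum.distrib sum_subtractf
      sum_negf)

lemma matrix_mult_zero_left [simp]: "0 ** (A :: complex^'c^'k) = 0"
  and matrix_mult_zero_right [simp]: "(B :: complex^'k^'r) ** 0 = 0"
  by (simp_all add: vec_eq_iff matrix_matrix_mult_def)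

lemmas matrix_distribs =
  matrix_add_ldistrib matrix_mult_add_left matrix_mult_diff_left matrix_mult_diff_right
  matrix_mult_minus_left matrix_mult_minus_right cscale_add cscale_diff
  cscale_minus_left cscale_minus_right

lemma adjoint_adjoint [simp]: "(A\<^sup>\<dagger>)\<^sup>\<dagger> = A"
  and adjoint_add: "(A + B)\<^sup>\<dagger> = A\<^sup>\<dagger> + B\<^sup>\<dagger>"
  and adjoint_diff: "(A - B)\<^sup>\<dagger> = A\<^sup>\<dagger> - B\<^sup>\<dagger>"
  and adjoint_minus: "(- A)\<^sup>\<dagger> = - (A\<^sup>\<dagger>)"
  and adjoint_cscale: "(c \<odot> A)\<^sup>\<dagger> = cnj c \<odot> A\<^sup>\<dagger>"
  by (simp_all add: vec_eq_iff cadjoint_def)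

lemma adjoint_mat [simp]: "(mat c)\<^sup>\<dagger> = mat (cnj c)"
  by (auto simp: vec_eq_iff cadjoint_def mat_def)

lemma adjoint_mult: "(A ** B)\<^sup>\<dagger> = B\<^sup>\<dagger> ** A\<^sup>\<dagger>"
  by (simp add: vec_eq_iff cadjoint_def matrix_matrix_mult_def mult.commute)

lemmas adjoint_simps = adjoint_add adjoint_diff adjoint_minus adjoint_cscale adjoint_mult

lemma bounded_bilinear_matrix_mult:
  "bounded_bilinear (\<lambda>(A :: complex^'k^'r) (B :: complex^'c^'k). A ** B)"
proof -
  have "bilinear (\<lambda>(A :: complex^'k^'r) (B :: complex^'c^'k). A ** B)"
    unfolding bilinear_def
    by (auto intro!: linearI simp: matrix_distribs scaleR_eq_cscale)
  then show ?thesis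
    by (simp add: bilinear_conv_bounded_bilinear)
qed

lemma bounded_linear_adjoint: "bounded_linear (\<lambda>A :: complex^'c^'r. A\<^sup>\<dagger>)"
  by (rule linear_linear[THEN iffD2], rule linearI)
    (simp_all add: adjoint_simps scaleR_eq_cscale)

lemma bounded_linear_cscale: "bounded_linear (\<lambda>A :: complex^'c^'r. c \<odot> A)"
  by (rule linear_linear[THEN iffD2], rule linearI)
    (simp_all add: cscale_add scaleR_eq_cscale mult.commute)

lemmas has_vector_derivative_matrix_mult =
  bounded_bilinear.has_vector_derivative[OF bounded_bilinear_matrix_mult]
lemmas has_vector_derivative_adjoint =
  bounded_linear.has_vector_derivative[OF bounded_linear_adjoint]
lemmas has_vector_derivative_cscale =
  bounded_linear.has_vector_derivative[OF bounded_linear_cscale]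
lemmas continuous_on_matrix_mult [continuous_intros] =
  bounded_bilinear.continuous_on[OF bounded_bilinear_matrix_mult]
lemmas tendsto_matrix_mult [tendsto_intros] =
  bounded_bilinear.tendsto[OF bounded_bilinear_matrix_mult]
lemmas continuous_on_adjoint [continuous_intros] =
  bounded_linear.continuous_on[OF bounded_linear_adjoint]
lemmas continuous_on_cscale [continuous_intros] =
  bounded_linear.continuous_on[OF bounded_linear_cscale]

text \<open>The real inner product of complex matrices is \<open>Re (trace (A\<^sup>\<dagger> ** B))\<close>, which lets products
  move from one side to the other and turns norms of matrices into values of quadratic forms.\<close>

lemma inner_matrix: "A \<bullet> B = (\<Sum>i\<in>UNIV. \<Sum>j\<in>UNIV. Re (cnj (A $ i $ j) * B $ i $ j))"
  by (simp add: inner_vec_def inner_complex_def)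

lemma inner_matrix_mult_left: "(A ** B) \<bullet> C = B \<bullet> (A\<^sup>\<dagger> ** C)" for A :: "complex^'k^'r"
proof -
  have "(A ** B) \<bullet> C = (\<Sum>i\<in>UNIV. \<Sum>j\<in>UNIV. \<Sum>k\<in>UNIV. Re (cnj (A $ i $ k * B $ k $ j) * C $ i $ j))"
    by (simp only: inner_matrix) (simp add: matrix_matrix_mult_def sum_distrib_right Re_sum)
  also have "\<dots> = (\<Sum>i\<in>UNIV. \<Sum>k\<in>UNIV. \<Sum>j\<in>UNIV. Re (cnj (A $ i $ k * B $ k $ j) * C $ i $ j))"
    by (intro sum.cong refl sum.swap)
  also have "\<dots> = (\<Sum>k\<in>UNIV. \<Sum>i\<in>UNIV. \<Sum>j\<in>UNIV. Re (cnj (A $ i $ k * B $ k $ j) * C $ i $ j))"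
    by (rule sum.swap)
  also have "\<dots> = (\<Sum>k\<in>UNIV. \<Sum>j\<in>UNIV. \<Sum>i\<in>UNIV. Re (cnj (A $ i $ k * B $ k $ j) * C $ i $ j))"
    by (intro sum.cong refl sum.swap)
  also have "\<dots> = B \<bullet> (A\<^sup>\<dagger> ** C)"
    by (simp only: inner_matrix)
      (simp add: matrix_matrix_mult_def cadjoint_def sum_distrib_left Re_sum mult_ac)
  finally show ?thesis .
qed

lemma inner_cscale_left: "(c \<odot> A) \<bullet> B = A \<bullet> (cnj c \<odot> B)"
  by (simp only: inner_matrix) (simp add: mult_ac)

text \<open>Only the real part of \<open>c\<close> survives because a Hermitian form takes real values.\<close>

lemma inner_cscale_hermitian:
  fixes M :: "complex^'n^'n"
  assumes "M\<^sup>\<dagger> = M"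
  shows "A \<bullet> (c \<odot> (M ** A)) = Re c * (A \<bullet> (M ** A))"
proof -
  have "A \<bullet> (\<i> \<odot> (M ** A)) = (- \<i> \<odot> A) \<bullet> (M ** A)"
    by (simp add: inner_cscale_left)
  also have "\<dots> = (M ** (- \<i> \<odot> A)) \<bullet> A"
    by (simp only: inner_matrix_mult_left assms)
  also have "\<dots> = - (A \<bullet> (\<i> \<odot> (M ** A)))"
    by (simp add: cscale_minus_left matrix_mult_minus_right inner_commute)
  finally have "A \<bullet> (\<i> \<odot> (M ** A)) = 0"
    by simp
  moreover have "c \<odot> (M ** A) = Re c *\<^sub>R (M ** A) + Im c *\<^sub>R (\<i> \<odot> (M ** A))"
  proof -
    have "complex_of_real (Re c) + complex_of_real (Im c) * \<i> = c"
      by (simp add: complex_eq_iff)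
    then show ?thesis
      by (simp add: scaleR_eq_cscale flip: cscale_add_left)
  qed
  ultimately show ?thesis
    by (simp add: inner_add_right)
qed

text \<open>A square matrix \<open>A\<close> all of whose columns equal one kernel vector turns the kernel condition for
  vectors into one for matrices. So the matrix inner product above also serves for invertibility.\<close>

lemma invertible_if_no_kernel:
  fixes M :: "complex^'n^'n"
  assumes "\<And>A :: complex^'n^'n. M ** A = 0 \<Longrightarrow> A = 0"
  shows "invertible M"
proof -
  have "v = 0" if "M *v v = 0" for v
  proof -
    have "M ** (\<chi> i j. v $ i) = (0 :: complex^'n^'n)"
      using that by (simp add: vec_eq_iff matrix_matrix_mult_def matrix_vector_mult_def)
    from assms[OF this] show ?thesis
      by (simp add: vec_eq_iff)
  qed
  then show ?thesis
    unfolding invertible_left_inverse matrix_left_invertible_ker by blast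
qed

lemma matrix_inv_mult:
  fixes M :: "complex^'n^'n"
  assumes "invertible M"
  shows "M ** matrix_inv M = mat 1" "matrix_inv M ** M = mat 1"
proof -
  from assms obtain N where "M ** N = mat 1 \<and> N ** M = mat 1"
    unfolding invertible_def by blast
  then have "M ** matrix_inv M = mat 1 \<and> matrix_inv M ** M = mat 1"
    unfolding matrix_inv_def by (rule someI)
  then show "M ** matrix_inv M = mat 1" "matrix_inv M ** M = mat 1"
    by simp_all
qed


section \<open>Block matrices\<close>

lemma above_eqI:
  assumes "\<And>k. A $ Inl k = B $ Inl k" "\<And>k. A $ Inr k = B $ Inr k"
  shows "(A :: complex^'n^('p::finite + 'q::finite)) = B"
proof (subst vec_eq_iff, rule allI)
  show "A $ i = B $ i" for i
    using assms by (cases i) auto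
qed

lemma sum_UNIV_sum:
  "(\<Sum>i\<in>(UNIV :: ('p::finite + 'q::finite) set). f i) = (\<Sum>i\<in>UNIV. f (Inl i)) + (\<Sum>i\<in>UNIV. f (Inr i))"
  using sum.Plus[of UNIV UNIV f] by (simp add: UNIV_Plus_UNIV)

lemma above_nth [simp]: "above A B $ Inl k = A $ k" "above A B $ Inr l = B $ l"
  by (simp_all add: above_def)

lemma beside_nth [simp]: "beside A B $ i $ Inl k = A $ i $ k" "beside A B $ i $ Inr l = B $ i $ l"
  by (simp_all add: beside_def)

lemma beside_mult_above: "beside A B ** above C D = A ** C + B ** D"
  by (simp add: vec_eq_iff matrix_matrix_mult_def sum_UNIV_sum)

lemma above_mult: "above A B ** C = above (A ** C) (B ** C)"
  by (rule above_eqI) (simp_all add: vec_eq_iff matrix_matrix_mult_def)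

lemma adjoint_above: "(above A B)\<^sup>\<dagger> = beside (A\<^sup>\<dagger>) (B\<^sup>\<dagger>)"
  by (simp add: vec_eq_iff cadjoint_def beside_def above_def split: sum.split)

lemma adjoint_beside: "(beside A B)\<^sup>\<dagger> = above (A\<^sup>\<dagger>) (B\<^sup>\<dagger>)"
  by (simp add: vec_eq_iff cadjoint_def beside_def above_def split: sum.split)

lemma above_diff: "above A B - above C D = above (A - C) (B - D)"
  and cscale_above: "c \<odot> above A B = above (c \<odot> A) (c \<odot> B)"
  by (rule above_eqI; simp add: vec_eq_iff)+

lemma beside_left_right_block: "beside (left_block L) (right_block L) = L"
  by (simp add: vec_eq_iff beside_def left_block_def right_block_def split: sum.split)

lemma J_mult_above: "J ** above A B = above B A"
  by (simp add: J_def above_mult beside_mult_above)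

lemma J_J [simp]: "J ** J = mat 1"
proof -
  have "J ** J = above (beside (mat 1) 0) (beside 0 (mat 1))"
    by (subst (2) J_def) (rule J_mult_above)
  also have "\<dots> = mat 1"
    by (rule above_eqI) (auto simp: vec_eq_iff beside_def mat_def split: sum.split)
  finally show ?thesis .
qed

lemma adjoint_J [simp]: "J\<^sup>\<dagger> = J"
  by (simp add: vec_eq_iff cadjoint_def J_def beside_def above_def mat_def split: sum.split)

lemma J_J_mult [simp]: "J ** (J ** A) = A"
  by (simp add: matrix_mul_assoc)

section \<open>Spectrum and resolvent\<close>

text \<open>The characteristic polynomial is the determinant of a matrix of polynomials; it does not vanish
  at points outside the disc whose radius is a norm bound for \<open>A\<close>, so it has finitely many roots.\<close>

lemma finite_matrix_spectrum: "finite (matrix_spectrum (A :: complex^'n^'n))"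
proof -
  define P where "P = (\<chi> i j. [: A $ i $ j, - (mat 1 :: complex^'n^'n) $ i $ j :])"
  have poly_P: "poly (det P) z = det (A - mat z)" for z
    unfolding det_def P_def
    by (simp add: poly_sum poly_prod mat_def if_distrib[of "\<lambda>x. z * x"] cong: if_cong)
  obtain K where K: "\<And>B :: complex^'n^'n. norm (A ** B) \<le> norm B * K" and "K > 0"
    using bounded_linear.pos_bounded[OF
        bounded_bilinear.bounded_linear_right[OF bounded_bilinear_matrix_mult, of A]] by blast
  \<comment> \<open>A kernel vector at this \<open>z\<close> would be stretched by more than the bound \<open>K\<close> permits.\<close>
  define z where "z = complex_of_real (K + 1)"
  have "invertible (A - mat z)"
  proof (rule invertible_if_no_kernel)
    fix B :: "complex^'n^'n"
    assume "(A - mat z) ** B = 0"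
    then have "A ** B = (K + 1) *\<^sub>R B"
      by (simp add: matrix_distribs mat_mult_eq_cscale z_def scaleR_eq_cscale)
    then have "(K + 1) * norm B \<le> norm B * K"
      using K[of B] \<open>K > 0\<close> by simp
    then show "B = 0"
      by (simp add: algebra_simps)
  qed
  then have "det P \<noteq> 0"
    using poly_P[of z] by (auto simp: invertible_det_nz)
  then have "finite {z. poly (det P) z = 0}"
    by (rule poly_roots_finite)
  then show ?thesis
    by (simp add: matrix_spectrum_def invertible_det_nz poly_P)
qed

text \<open>Cramer's rule makes the entries of the resolvent quotients of determinants, hence holomorphic.\<close>

lemma matrix_inv_nth:
  fixes M :: "complex^'n^'n"
  assumes "invertible M"
  shows "matrix_inv M $ k $ l = det (\<chi> i j. if j = k then axis l 1 $ i else M $ i $ j) / det M"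
proof -
  have "M *v (matrix_inv M *v axis l 1) = axis l 1"
    by (simp add: matrix_vector_mul_assoc matrix_inv_mult[OF assms])
  then have "matrix_inv M *v axis l 1
      = (\<chi> k. det (\<chi> i j. if j = k then axis l 1 $ i else M $ i $ j) / det M)"
    using assms by (subst (asm) cramer) (auto simp: invertible_det_nz)
  then have "(matrix_inv M *v axis l 1) $ k
      = det (\<chi> i j. if j = k then axis l 1 $ i else M $ i $ j) / det M"
    by simp
  moreover have "(matrix_inv M *v axis l 1) $ k = matrix_inv M $ k $ l"
    by (simp add: matrix_vector_mult_def axis_def if_distrib[of "\<lambda>x. _ * x"] cong: if_cong)
  ultimately show ?thesis
    by simp
qed

lemma holomorphic_on_det:
  fixes F :: "complex \<Rightarrow> complex^'n^'n"
  assumes "\<And>i j. (\<lambda>z. F z $ i $ j) holomorphic_on X"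
  shows "(\<lambda>z. det (F z)) holomorphic_on X"
  unfolding det_def using assms by (intro holomorphic_intros)

lemma holomorphic_on_resolvent:
  "(\<lambda>z. matrix_inv (A - mat z) $ k $ l) holomorphic_on X"
  if "X \<inter> matrix_spectrum A = {}" for A :: "complex^'n^'n"
proof -
  have entries: "(\<lambda>z. (A - mat z) $ i $ j) holomorphic_on X" for i j
    by (cases "i = j") (auto simp: mat_def intro!: holomorphic_intros)
  have "(\<lambda>z. det (\<chi> i j. if j = k then axis l 1 $ i else (A - mat z) $ i $ j) / det (A - mat z))
      holomorphic_on X"
  proof (intro holomorphic_on_divide holomorphic_on_det)
    show "(\<lambda>z. (\<chi> i j. if j = k then axis l 1 $ i else (A - mat z) $ i $ j) $ i $ j) holomorphic_on X"
      for i j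
      using entries[of i j] by (cases "j = k") auto
    show "det (A - mat z) \<noteq> 0" if "z \<in> X" for z
      using that \<open>X \<inter> matrix_spectrum A = {}\<close>
      by (auto simp: matrix_spectrum_def invertible_det_nz)
  qed (rule entries)
  then show ?thesis
    by (rule holomorphic_transform)
      (use that in \<open>auto simp: matrix_spectrum_def matrix_inv_nth\<close>)
qed


section \<open>Differentiation and integration on the half-line\<close>

lemma has_vector_derivative_within_iff:
  "(f has_vector_derivative f') (at x within X) \<longleftrightarrow>
     ((\<lambda>y. (f y - f x) /\<^sub>R (y - x)) \<longlongrightarrow> f') (at x within X)"
proof -
  have "norm (f y - f x - (y - x) *\<^sub>R f') / norm (y - x) = norm ((f y - f x) /\<^sub>R (y - x) - f')"
    if "y \<noteq> x" for y
  proof -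
    have "(f y - f x) /\<^sub>R (y - x) - f' = (f y - f x - (y - x) *\<^sub>R f') /\<^sub>R (y - x)"
      using that by (simp add: scaleR_diff_right)
    then show ?thesis
      by (simp add: divide_inverse mult.commute)
  qed
  then have "((\<lambda>y. norm (f y - f x - (y - x) *\<^sub>R f') / norm (y - x)) \<longlongrightarrow> 0) (at x within X)
      \<longleftrightarrow> ((\<lambda>y. norm ((f y - f x) /\<^sub>R (y - x) - f')) \<longlongrightarrow> 0) (at x within X)"
    by (intro Lim_cong_within) auto
  also have "\<dots> \<longleftrightarrow> ((\<lambda>y. (f y - f x) /\<^sub>R (y - x)) \<longlongrightarrow> f') (at x within X)"
    by (simp add: tendsto_norm_zero_iff LIM_zero_iff)
  finally show ?thesis
    unfolding has_vector_derivative_def has_derivative_iff_norm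
    by (simp add: bounded_linear_scaleR_left)
qed

lemma constant_on_half_line:
  fixes f :: "real \<Rightarrow> 'a::real_normed_vector"
  assumes "\<And>x. x \<ge> 0 \<Longrightarrow> (f has_vector_derivative 0) (at x within {0..})" and "x \<ge> 0"
  shows "f x = f 0"
proof -
  obtain c where "\<And>x. x \<in> {0..} \<Longrightarrow> f x = c"
    using has_vector_derivative_zero_constant[of "{0::real..}" f] assms(1) by auto
  then show ?thesis
    using assms(2) by simp
qed

lemma antiderivative_on_half_line:
  fixes f :: "real \<Rightarrow> 'a::banach"
  assumes "continuous_on {0..} f"
  obtains F where "F 0 = a"
    "\<And>x. x \<ge> 0 \<Longrightarrow> (F has_vector_derivative f x) (at x within {0..})"
proof -
  define F where "F x = integral {0..x} f + a" for x
  have "(F has_vector_derivative f x) (at x within {0..})" if "x \<ge> 0" for x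
  proof -
    have "((\<lambda>u. integral {0..u} f) has_vector_derivative f x) (at x within {0..x + 1})"
      using that by (intro integral_has_vector_derivative continuous_on_subset[OF assms]) auto
    also have "at x within {0..x + 1} = at x within {0..}"
      using that by (intro at_within_nhd[of _ "{..<x + 1}"]) auto
    finally show ?thesis
      unfolding F_def by (simp add: has_vector_derivative_add_const)
  qed
  moreover have "F 0 = a"
    by (simp add: F_def)
  ultimately show thesis
    by (intro that)
qed

lemma nonneg_derivative_ge_initial:
  fixes f f' :: "real \<Rightarrow> real"
  assumes "\<And>x. x \<ge> 0 \<Longrightarrow> (f has_vector_derivative f' x) (at x within {0..})"
    and "\<And>x. x \<ge> 0 \<Longrightarrow> f' x \<ge> 0" and "0 \<le> x" "x \<le> y"
  shows "f x \<le> f y"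
proof -
  have "(f has_vector_derivative f' t) (at t within {x..y})" if "t \<in> {x..y}" for t
    using assms(1)[of t] that \<open>0 \<le> x\<close> by (auto intro: has_vector_derivative_within_subset)
  then have "(f' has_integral f y - f x) {x..y}"
    using \<open>x \<le> y\<close> by (intro fundamental_theorem_of_calculus) auto
  then have "0 \<le> f y - f x"
    by (rule has_integral_nonneg) (use assms in auto)
  then show ?thesis by simp
qed

text \<open>Bounded partial integrals make a nonnegative function integrable; here the partial integrals are
  increments of a function that is bounded below.\<close>

lemma integrable_if_minus_antiderivative_bounded_below:
  fixes f T :: "real \<Rightarrow> real"
  assumes T: "\<And>x. x \<ge> 0 \<Longrightarrow> (T has_vector_derivative - f x) (at x within {0..})"
    and nonneg: "\<And>x. x \<ge> 0 \<Longrightarrow> f x \<ge> 0"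
    and bound: "\<And>x. x \<ge> 0 \<Longrightarrow> T x \<ge> B"
  shows "f integrable_on {0..}"
proof -
  define g where "g n x = (if x \<in> {0..real n} then f x else 0)" for n :: nat and x
  have int: "(f has_integral T 0 - T x) {0..x}" if "x \<ge> 0" for x
  proof -
    have "((\<lambda>x. - T x) has_vector_derivative f t) (at t within {0..x})" if "t \<in> {0..x}" for t
      using has_vector_derivative_minus[OF T[of t]] that
      by (auto intro: has_vector_derivative_within_subset)
    then have "(f has_integral - T x - - T 0) {0..x}"
      using that by (intro fundamental_theorem_of_calculus) auto
    then show ?thesis by simp
  qed
  have g_int: "(g n has_integral T 0 - T n) {0..}" for n
  proof -
    have "(g n has_integral T 0 - T n) UNIV"
      unfolding g_def using int[of n] by (subst has_integral_restrict_UNIV) auto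
    moreover have "g n = (\<lambda>x. if x \<in> {0..} then g n x else 0)"
      by (auto simp: g_def)
    ultimately show ?thesis
      by (metis has_integral_restrict_UNIV)
  qed
  have "f integrable_on {0..} \<and> (\<lambda>n. integral {0..} (g n)) \<longlonglongrightarrow> integral {0..} f"
  proof (rule monotone_convergence_increasing)
    show "g n integrable_on {0..}" for n
      using g_int by blast
    show "g n x \<le> g (Suc n) x" if "x \<in> {0..}" for n x
      using that nonneg by (auto simp: g_def)
    show "(\<lambda>n. g n x) \<longlonglongrightarrow> f x" if "x \<in> {0..}" for x
    proof (rule tendsto_eventually)
      show "\<forall>\<^sub>F n in sequentially. g n x = f x"
        using eventually_ge_at_top[of "nat \<lceil>x\<rceil>"]
        by eventually_elim (use that in \<open>auto simp: g_def\<close>)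
    qed
    have "integral {0..} (g n) \<in> {0..T 0 - B}" for n
      using has_integral_nonneg[OF g_int[of n]] bound[of n] nonneg integral_unique[OF g_int[of n]]
      by (auto simp: g_def)
    then have "range (\<lambda>n. integral {0..} (g n)) \<subseteq> {0..T 0 - B}"
      by blast
    then show "bounded (range (\<lambda>n. integral {0..} (g n)))"
      by (rule bounded_subset[OF bounded_closed_interval])
  qed
  then show ?thesis by blast
qed

text \<open>The number \<open>b\<close> in the proof is where the area \<open>e * (b - a)\<close> exceeds the whole integral.\<close>

lemma not_integrable_if_bounded_away:
  fixes f :: "real \<Rightarrow> real"
  assumes "f integrable_on {0..}" "\<And>x. x \<ge> 0 \<Longrightarrow> f x \<ge> 0"
    and "e > 0" "a \<ge> 0" "\<And>x. x \<ge> a \<Longrightarrow> f x \<ge> e"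
  shows False
proof -
  define b where "b = a + (integral {0..} f + 1) / e"
  have I: "integral {0..} f \<ge> 0"
    using assms by (intro integral_nonneg) auto
  then have "b \<ge> a"
    using \<open>e > 0\<close> by (simp add: b_def)
  have sub: "f integrable_on {a..b}"
    using integrable_on_subinterval[OF assms(1)] \<open>a \<ge> 0\<close> by (auto simp: subset_iff)
  have "integral {a..b} (\<lambda>x. e) \<le> integral {a..b} f"
    using assms sub by (intro integral_le) auto
  also have "\<dots> \<le> integral {0..} f"
    using assms sub by (intro integral_subset_le) auto
  finally have "(b - a) * e \<le> integral {0..} f"
    using \<open>b \<ge> a\<close> by simp
  then show False
    using \<open>e > 0\<close> by (simp add: b_def)
qed

text \<open>Differentiating \<open>M ** matrix_inv M = mat 1\<close> needs the inverse to be differentiable. The resolvent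
  identity \<open>N\<^sup>-\<^sup>1 - M\<^sup>-\<^sup>1 = - N\<^sup>-\<^sup>1 (N - M) M\<^sup>-\<^sup>1\<close> gives the difference quotient, and it shows that
  a bounded inverse is continuous.\<close>

lemma has_vector_derivative_matrix_inv:
  fixes M :: "real \<Rightarrow> complex^'n^'n"
  assumes M: "(M has_vector_derivative M') (at x within X)" and "x \<in> X"
    and inv: "\<And>y. y \<in> X \<Longrightarrow> invertible (M y)"
    and bound: "\<And>y. y \<in> X \<Longrightarrow> norm (matrix_inv (M y)) \<le> K"
  shows "((\<lambda>y. matrix_inv (M y)) has_vector_derivative
           - (matrix_inv (M x) ** M' ** matrix_inv (M x))) (at x within X)"
proof -
  let ?S = "\<lambda>y. matrix_inv (M y)"
  have res: "?S y - ?S x = - (?S y ** (M y - M x) ** ?S x)" if "y \<in> X" for y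
    by (simp add: matrix_distribs matrix_inv_mult inv that \<open>x \<in> X\<close> flip: matrix_mul_assoc)
  obtain C where C: "\<And>(A :: complex^'n^'n) (B :: complex^'n^'n). norm (A ** B) \<le> norm A * norm B * C"
    and "C > 0"
    using bounded_bilinear.pos_bounded[OF bounded_bilinear_matrix_mult] by blast
  have contM: "(M \<longlongrightarrow> M x) (at x within X)"
    using has_vector_derivative_continuous[OF M] by (simp add: continuous_within)
  have "((\<lambda>y. ?S y - ?S x) \<longlongrightarrow> 0) (at x within X)"
  proof (rule tendsto_0_le[where K = "K * C * C * norm (?S x)"])
    show "((\<lambda>y. M y - M x) \<longlongrightarrow> 0) (at x within X)"
      using contM by (rule LIM_zero)
    have "norm (?S y - ?S x) \<le> norm (M y - M x) * (K * C * C * norm (?S x))" if "y \<in> X" for y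
    proof -
      have "norm (?S y - ?S x) \<le> norm (?S y ** (M y - M x)) * norm (?S x) * C"
        using res[OF that] C by simp
      also have "\<dots> \<le> (norm (?S y) * norm (M y - M x) * C) * norm (?S x) * C"
        using \<open>C > 0\<close> C by (intro mult_right_mono) auto
      also have "\<dots> \<le> (K * norm (M y - M x) * C) * norm (?S x) * C"
        using \<open>C > 0\<close> bound[OF that] by (intro mult_right_mono) auto
      finally show ?thesis by (simp add: mult_ac)
    qed
    then show "\<forall>\<^sub>F y in at x within X. norm (?S y - ?S x) \<le> norm (M y - M x) * (K * C * C * norm (?S x))"
      by (auto simp: eventually_at_filter)
  qed
  then have contS: "(?S \<longlongrightarrow> ?S x) (at x within X)"
    by (rule LIM_zero_cancel)
  have "((\<lambda>y. - (?S y ** ((M y - M x) /\<^sub>R (y - x)) ** ?S x)) \<longlongrightarrow> - (?S x ** M' ** ?S x))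
      (at x within X)"
    using M unfolding has_vector_derivative_within_iff
    by (intro tendsto_minus tendsto_matrix_mult contS tendsto_const)
  then show ?thesis
    unfolding has_vector_derivative_within_iff
  proof (rule Lim_transform_eventually)
    have "- (?S y ** ((M y - M x) /\<^sub>R (y - x)) ** ?S x) = (?S y - ?S x) /\<^sub>R (y - x)" if "y \<in> X" for y
      using res[OF that] by (simp add: scaleR_eq_cscale cscale_minus_right)
    then show "\<forall>\<^sub>F y in at x within X.
        - (?S y ** ((M y - M x) /\<^sub>R (y - x)) ** ?S x) = (?S y - ?S x) /\<^sub>R (y - x)"
      by (auto simp: eventually_at_filter)
  qed
qed


text \<open>The trace of \<open>s\<^sup>\<dagger> ** s\<close> is \<open>norm s\<close> squared, and it dominates all entries.\<close>

lemma absolutely_integrable_gram_iff: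
  fixes s :: "real \<Rightarrow> complex^'c^'r"
  assumes cont: "continuous_on {0..} s"
  shows "(\<lambda>x. (s x)\<^sup>\<dagger> ** s x) absolutely_integrable_on {0..} \<longleftrightarrow>
         (\<lambda>x. (norm (s x))\<^sup>2) integrable_on {0..}"
proof
  have "bounded_linear (\<lambda>A :: complex^'c^'c. A \<bullet> mat 1)"
    by (rule bounded_linear_inner_left)
  moreover assume "(\<lambda>x. (s x)\<^sup>\<dagger> ** s x) absolutely_integrable_on {0..}"
  then have "(\<lambda>x. (s x)\<^sup>\<dagger> ** s x) integrable_on {0..}"
    by (rule set_lebesgue_integral_eq_integral(1))
  ultimately have "((\<lambda>A. A \<bullet> mat 1) \<circ> (\<lambda>x. (s x)\<^sup>\<dagger> ** s x)) integrable_on {0..}"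
    by (intro integrable_linear)
  moreover have "((s x)\<^sup>\<dagger> ** s x) \<bullet> mat 1 = (norm (s x))\<^sup>2" for x
    by (simp add: inner_matrix_mult_left power2_norm_eq_inner)
  ultimately show "(\<lambda>x. (norm (s x))\<^sup>2) integrable_on {0..}"
    by (simp add: o_def)
next
  assume int: "(\<lambda>x. (norm (s x))\<^sup>2) integrable_on {0..}"
  obtain C where C: "\<And>(A :: complex^'r^'c) (B :: complex^'c^'r). norm (A ** B) \<le> norm A * norm B * C"
    using bounded_bilinear.pos_bounded[OF bounded_bilinear_matrix_mult] by blast
  have norm_adjoint: "norm (A\<^sup>\<dagger>) = norm A" for A :: "complex^'c^'r"
    unfolding norm_eq_sqrt_inner inner_matrix
    by (subst sum.swap) (simp add: cadjoint_def mult.commute)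
  show "(\<lambda>x. (s x)\<^sup>\<dagger> ** s x) absolutely_integrable_on {0..}"
  proof (rule measurable_bounded_by_integrable_imp_absolutely_integrable)
    show "(\<lambda>x. (s x)\<^sup>\<dagger> ** s x) \<in> borel_measurable (lebesgue_on {0..})"
      by (intro continuous_imp_measurable_on_sets_lebesgue continuous_intros cont) auto
    show "(\<lambda>x. C * (norm (s x))\<^sup>2) integrable_on {0..}"
      using integrable_on_cmult_left[OF int, of C] by simp
    show "norm ((s x)\<^sup>\<dagger> ** s x) \<le> C * (norm (s x))\<^sup>2" for x
      using C[of "(s x)\<^sup>\<dagger>" "s x"] by (simp add: norm_adjoint power2_eq_square mult_ac)
  qed auto
qed

lemmas matrix_derivative_intros =
  has_vector_derivative_const has_vector_derivative_add has_vector_derivative_diff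
  has_vector_derivative_matrix_mult has_vector_derivative_cscale has_vector_derivative_adjoint

section \<open>The canonical system and its energy identity\<close>

text \<open>The hypothesis says that \<open>J ** A\<^sup>\<dagger> ** J\<close> is a right inverse of \<open>A\<close>; it is then a left inverse.\<close>

lemma J_unitary_adjoint:
  fixes A :: "complex^('p + 'p)^('p::finite + 'p)"
  assumes "A ** J ** A\<^sup>\<dagger> = J"
  shows "A\<^sup>\<dagger> ** J ** A = J"
proof -
  have "A ** (J ** A\<^sup>\<dagger> ** J) = mat 1"
    using assms by (simp add: matrix_mul_assoc)
  then have "J ** A\<^sup>\<dagger> ** J ** A = mat 1"
    by (rule matrix_left_right_inverse[THEN iffD1])
  then have "J ** (J ** A\<^sup>\<dagger> ** J ** A) = J"
    by simp
  then show ?thesis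
    by (simp flip: matrix_mul_assoc)
qed

lemma adjoint_diag_matrix [simp]: "(diag_matrix d)\<^sup>\<dagger> = diag_matrix d"
  by (simp add: vec_eq_iff cadjoint_def diag_matrix_def)

locale explicit_system =
  fixes d :: "'p::finite \<Rightarrow> real"
    and D :: "complex^'p^'p"
    and \<alpha> :: "complex^'n^'n"
    and \<Lambda> :: "real \<Rightarrow> complex^('p + 'p)^'n"
    and \<Sigma> :: "real \<Rightarrow> complex^'n^'n"
    and v0 H :: "real \<Rightarrow> complex^('p + 'p)^('p + 'p)"
    and w :: "real \<Rightarrow> complex \<Rightarrow> complex^('p + 'p)^('p + 'p)"
  assumes D: "D = diag_matrix d"
    and alpha: "\<alpha> - \<alpha>\<^sup>\<dagger> = mat \<i> ** \<Lambda> 0 ** J ** (\<Lambda> 0)\<^sup>\<dagger>"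
    and Lambda: "\<And>x. x \<ge> 0 \<Longrightarrow>
      (\<Lambda> has_vector_derivative mat (- \<i>) ** \<alpha> ** \<Lambda> x ** J ** H0 D) (at x within {0..})"
    and Sigma0: "\<Sigma> 0 = mat 1"
    and Sigma: "\<And>x. x \<ge> 0 \<Longrightarrow>
      (\<Sigma> has_vector_derivative Psi1 D (\<Lambda> x) ** (Psi1 D (\<Lambda> x))\<^sup>\<dagger>) (at x within {0..})"
    and v0_0: "v0 0 = mat 1"
    and v0: "\<And>x. x \<ge> 0 \<Longrightarrow>
      (v0 has_vector_derivative - (q0 D (\<Lambda> x) (\<Sigma> x) ** v0 x)) (at x within {0..})"
    and H: "\<And>x. x \<ge> 0 \<Longrightarrow> H x = (v0 x)\<^sup>\<dagger> ** H0 D ** v0 x"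
    and w: "fundamental_solution H w"
begin

text \<open>The Hamiltonian \<open>H0 D\<close> factors as \<open>R\<^sup>\<dagger> ** R\<close>, which turns energy densities into squares of norms.\<close>

definition R :: "complex^('p + 'p)^'p" where
  "R = beside ((1/2) *\<^sub>R D) (mat 1)"

lemma adjoint_D [simp]: "D\<^sup>\<dagger> = D"
  by (simp add: D)

lemma adjoint_R: "R\<^sup>\<dagger> = above ((1/2) *\<^sub>R D) (mat 1)"
  by (simp add: R_def adjoint_beside adjoint_cscale scaleR_eq_cscale)

lemma H0_eq: "H0 D = R\<^sup>\<dagger> ** R"
  by (simp add: H0_def adjoint_R) (simp add: R_def)

lemma adjoint_H0 [simp]: "(H0 D)\<^sup>\<dagger> = H0 D"
  by (simp add: H0_eq adjoint_mult)

lemma Psi1_eq: "Psi1 D L = L ** J ** R\<^sup>\<dagger>"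
  by (simp add: Psi1_def adjoint_R J_mult_above flip: matrix_mul_assoc)

lemma Psi1_Psi1: "Psi1 D L ** (Psi1 D L)\<^sup>\<dagger> = L ** J ** H0 D ** J ** L\<^sup>\<dagger>"
  by (simp add: Psi1_eq H0_eq adjoint_mult flip: matrix_mul_assoc)

lemma adjoint_H: "x \<ge> 0 \<Longrightarrow> (H x)\<^sup>\<dagger> = H x"
  by (simp add: H adjoint_mult matrix_mul_assoc)


subsection \<open>The matrix \<open>\<Sigma>\<close> and its inverse\<close>

lemma adjoint_Sigma:
  assumes "x \<ge> 0"
  shows "(\<Sigma> x)\<^sup>\<dagger> = \<Sigma> x"
proof -
  have "((\<lambda>x. (\<Sigma> x)\<^sup>\<dagger> - \<Sigma> x) has_vector_derivative 0) (at x within {0..})" if "x \<ge> 0" for x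
    using has_vector_derivative_diff[OF has_vector_derivative_adjoint[OF Sigma[OF that]] Sigma[OF that]]
    by (simp add: adjoint_mult)
  from constant_on_half_line[OF this assms] show ?thesis
    by (simp add: Sigma0)
qed

text \<open>Since \<open>\<Sigma>\<close> has a positive semidefinite derivative, it stays above its initial value \<open>1\<close>.\<close>

lemma inner_Sigma_ge:
  fixes A :: "complex^'c^'n"
  assumes "x \<ge> 0"
  shows "A \<bullet> A \<le> A \<bullet> (\<Sigma> x ** A)"
proof -
  have "((\<lambda>x. A \<bullet> (\<Sigma> x ** A)) has_vector_derivative (norm ((Psi1 D (\<Lambda> x))\<^sup>\<dagger> ** A))\<^sup>2)
      (at x within {0..})" if "x \<ge> 0" for x
  proof -
    have "((\<lambda>x. A \<bullet> (\<Sigma> x ** A)) has_vector_derivative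
        A \<bullet> (Psi1 D (\<Lambda> x) ** (Psi1 D (\<Lambda> x))\<^sup>\<dagger> ** A)) (at x within {0..})"
      by (intro bounded_linear.has_vector_derivative[OF bounded_linear_inner_right]
          bounded_linear.has_vector_derivative[OF
            bounded_bilinear.bounded_linear_left[OF bounded_bilinear_matrix_mult]] Sigma that)
    also have "A \<bullet> (Psi1 D (\<Lambda> x) ** (Psi1 D (\<Lambda> x))\<^sup>\<dagger> ** A) = (norm ((Psi1 D (\<Lambda> x))\<^sup>\<dagger> ** A))\<^sup>2"
      by (simp add: power2_norm_eq_inner inner_matrix_mult_left matrix_mul_assoc)
    finally show ?thesis .
  qed
  from nonneg_derivative_ge_initial[OF this, of 0 x] assms show ?thesis
    by (simp add: Sigma0)
qed

lemma invertible_Sigma: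
  assumes "x \<ge> 0"
  shows "invertible (\<Sigma> x)"
proof (rule invertible_if_no_kernel)
  fix A :: "complex^'n^'n"
  assume "\<Sigma> x ** A = 0"
  then have "A \<bullet> A \<le> 0"
    using inner_Sigma_ge[OF assms, of A] by simp
  then show "A = 0"
    by (metis inner_eq_zero_iff inner_ge_zero order_antisym)
qed

definition S :: "real \<Rightarrow> complex^'n^'n" where
  "S x = matrix_inv (\<Sigma> x)"

lemma Sigma_S: "x \<ge> 0 \<Longrightarrow> \<Sigma> x ** S x = mat 1" "x \<ge> 0 \<Longrightarrow> S x ** \<Sigma> x = mat 1"
  by (simp_all add: S_def matrix_inv_mult invertible_Sigma)

lemma adjoint_S:
  assumes "x \<ge> 0"
  shows "(S x)\<^sup>\<dagger> = S x"
proof -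
  have "(S x)\<^sup>\<dagger> = (S x)\<^sup>\<dagger> ** (\<Sigma> x)\<^sup>\<dagger> ** S x"
    by (simp add: adjoint_Sigma Sigma_S assms flip: matrix_mul_assoc)
  also have "\<dots> = (\<Sigma> x ** S x)\<^sup>\<dagger> ** S x"
    by (simp only: adjoint_mult)
  also have "\<dots> = S x"
    by (simp add: Sigma_S assms)
  finally show ?thesis .
qed

lemma norm_S_le:
  assumes "x \<ge> 0"
  shows "norm (S x) \<le> norm (mat 1 :: complex^'n^'n)"
proof (cases "S x = 0")
  case False
  have "norm (S x) * norm (S x) \<le> S x \<bullet> (\<Sigma> x ** S x)"
    using inner_Sigma_ge[OF assms, of "S x"] by (simp add: dot_square_norm power2_eq_square)
  also have "\<dots> \<le> norm (S x) * norm (mat 1 :: complex^'n^'n)"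
    by (simp only: Sigma_S[OF assms] norm_cauchy_schwarz)
  finally show ?thesis
    using False by simp
qed simp

lemma S_has_derivative:
  assumes "x \<ge> 0"
  shows "(S has_vector_derivative - (S x ** \<Lambda> x ** J ** H0 D ** J ** (\<Lambda> x)\<^sup>\<dagger> ** S x)) (at x within {0..})"
proof -
  have "((\<lambda>y. matrix_inv (\<Sigma> y)) has_vector_derivative
      - (matrix_inv (\<Sigma> x) ** (Psi1 D (\<Lambda> x) ** (Psi1 D (\<Lambda> x))\<^sup>\<dagger>) ** matrix_inv (\<Sigma> x))) (at x within {0..})"
    using assms norm_S_le
    by (intro has_vector_derivative_matrix_inv[OF Sigma] invertible_Sigma) (auto simp: S_def)
  then show ?thesis
    by (simp add: Psi1_Psi1 matrix_mul_assoc flip: S_def)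
qed

text \<open>The initial identity for \<open>\<alpha>\<close> propagates along the system: both sides have the derivative
  \<open>\<alpha> ** Psi1 ** Psi1\<^sup>\<dagger> - Psi1 ** Psi1\<^sup>\<dagger> ** \<alpha>\<^sup>\<dagger>\<close>, where \<open>Psi1\<close> is taken at \<open>\<Lambda> x\<close>. Multiplied by \<open>S\<close> from
  both sides it lets \<open>\<alpha>\<close> pass through \<open>S\<close>; all later computations rest on that.\<close>

lemma alpha_Sigma_identity:
  assumes "x \<ge> 0"
  shows "\<alpha> ** \<Sigma> x - \<Sigma> x ** \<alpha>\<^sup>\<dagger> = \<i> \<odot> (\<Lambda> x ** J ** (\<Lambda> x)\<^sup>\<dagger>)"
proof -
  have "((\<lambda>x. \<alpha> ** \<Sigma> x - \<Sigma> x ** \<alpha>\<^sup>\<dagger> - \<i> \<odot> (\<Lambda> x ** J ** (\<Lambda> x)\<^sup>\<dagger>)) has_vector_derivative 0)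
      (at x within {0..})" if "x \<ge> 0" for x
    by (rule has_vector_derivative_eq_rhs, (rule matrix_derivative_intros Sigma Lambda that)+)
      (simp add: Psi1_Psi1 matrix_distribs mat_mult_eq_cscale adjoint_simps flip: matrix_mul_assoc)
  from constant_on_half_line[OF this assms] show ?thesis
    using alpha by (simp add: Sigma0 mat_mult_eq_cscale)
qed

lemma S_alpha:
  assumes "x \<ge> 0"
  shows "S x ** \<alpha> = \<alpha>\<^sup>\<dagger> ** S x + \<i> \<odot> (S x ** \<Lambda> x ** J ** (\<Lambda> x)\<^sup>\<dagger> ** S x)"
proof -
  have "S x ** (\<alpha> ** \<Sigma> x - \<Sigma> x ** \<alpha>\<^sup>\<dagger>) ** S x = S x ** \<alpha> ** (\<Sigma> x ** S x) - (S x ** \<Sigma> x) ** \<alpha>\<^sup>\<dagger> ** S x"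
    by (simp add: matrix_distribs matrix_mul_assoc)
  then show ?thesis
    by (simp add: alpha_Sigma_identity Sigma_S assms matrix_mul_assoc algebra_simps)
qed

lemma adjoint_q0_J:
  assumes "x \<ge> 0"
  shows "(q0 D (\<Lambda> x) (\<Sigma> x))\<^sup>\<dagger> ** J = - (J ** q0 D (\<Lambda> x) (\<Sigma> x))"
  using adjoint_S[OF assms]
  by (simp add: q0_def matrix_distribs adjoint_simps flip: matrix_mul_assoc S_def)

text \<open>The first identity cannot be obtained by differentiating its left side, since \<open>q0\<close> does not cancel
  there; it follows from the second, where \<open>q0\<^sup>\<dagger> ** J + J ** q0\<close> appears in the middle.\<close>

lemma v0_J_unitary:
  assumes "x \<ge> 0"
  shows "v0 x ** J ** (v0 x)\<^sup>\<dagger> = J" "(v0 x)\<^sup>\<dagger> ** J ** v0 x = J"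
proof -
  have "((\<lambda>x. (v0 x)\<^sup>\<dagger> ** J ** v0 x) has_vector_derivative 0) (at x within {0..})"
    if "x \<ge> 0" for x
  proof -
    define q where "q = q0 D (\<Lambda> x) (\<Sigma> x)"
    have q: "q\<^sup>\<dagger> ** (J ** A) = - (J ** (q ** A))" for A :: "complex^('p + 'p)^('p + 'p)"
      using adjoint_q0_J[OF that] by (simp add: q_def matrix_mul_assoc matrix_mult_minus_left)
    show ?thesis
      by (rule has_vector_derivative_eq_rhs, (rule matrix_derivative_intros v0 that)+)
        (simp add: matrix_distribs adjoint_simps q flip: q_def matrix_mul_assoc)
  qed
  from constant_on_half_line[OF this assms] show *: "(v0 x)\<^sup>\<dagger> ** J ** v0 x = J"
    by (simp add: v0_0)
  show "v0 x ** J ** (v0 x)\<^sup>\<dagger> = J"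
    using J_unitary_adjoint[of "(v0 x)\<^sup>\<dagger>"] * by simp
qed


subsection \<open>Solutions and their energy\<close>

text \<open>The column type is arbitrary, so that \<open>Y\<close> may collect any number of solution vectors.\<close>

definition solves :: "complex \<Rightarrow> (real \<Rightarrow> complex^'c^('p + 'p)) \<Rightarrow> bool" where
  "solves z Y \<longleftrightarrow>
     (\<forall>x\<ge>0. (Y has_vector_derivative (\<i> * z) \<odot> (J ** H x ** Y x)) (at x within {0..}))"

lemma solvesD:
  "solves z Y \<Longrightarrow> x \<ge> 0 \<Longrightarrow>
     (Y has_vector_derivative (\<i> * z) \<odot> (J ** H x ** Y x)) (at x within {0..})"
  by (simp add: solves_def)

lemma solves_fundamental: "solves z (\<lambda>x. w x z ** C)"
proof -
  have "((\<lambda>x. w x z ** C) has_vector_derivative (\<i> * z) \<odot> (J ** H x ** (w x z ** C))) (at x within {0..})"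
    if "x \<ge> 0" for x
  proof -
    have w': "((\<lambda>x. w x z) has_vector_derivative mat (\<i> * z) ** J ** H x ** w x z) (at x within {0..})"
      using w that by (simp add: fundamental_solution_def)
    show ?thesis
      by (rule has_vector_derivative_eq_rhs, (rule matrix_derivative_intros w')+)
        (simp add: mat_mult_eq_cscale flip: matrix_mul_assoc)
  qed
  then show ?thesis
    by (simp add: solves_def)
qed

lemma w_0 [simp]: "w 0 z = mat 1"
  using w by (simp add: fundamental_solution_def)

lemma solutions_pairing_constant:
  assumes Y: "solves z Y" and W: "solves (cnj z) W" and "x \<ge> 0"
  shows "(W x)\<^sup>\<dagger> ** J ** Y x = (W 0)\<^sup>\<dagger> ** J ** Y 0"
proof -
  have "((\<lambda>x. (W x)\<^sup>\<dagger> ** J ** Y x) has_vector_derivative 0) (at x within {0..})" if "x \<ge> 0" for x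
    by (rule has_vector_derivative_eq_rhs,
        (rule matrix_derivative_intros solvesD[OF Y that] solvesD[OF W that])+)
      (simp add: matrix_distribs adjoint_simps adjoint_H that mult.commute flip: matrix_mul_assoc)
  from constant_on_half_line[OF this \<open>x \<ge> 0\<close>] show ?thesis .
qed

text \<open>The pairing identity with \<open>w\<close> at the conjugate point inverts \<open>w x z\<close> without determinants, and
  so replaces a uniqueness theorem for linear differential equations.\<close>

lemma solution_eq:
  assumes Y: "solves z Y" and x: "x \<ge> 0"
  shows "Y x = w x z ** Y 0"
proof -
  have W: "solves (cnj z) (\<lambda>x. w x (cnj z))"
    using solves_fundamental[of "cnj z" "mat 1"] by simp
  have wz: "solves z (\<lambda>x. w x z)"
    using solves_fundamental[of z "mat 1"] by simp
  have "(w x (cnj z))\<^sup>\<dagger> ** J ** w x z = J"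
    using solutions_pairing_constant[OF wz W x] by simp
  then have "J ** (w x (cnj z))\<^sup>\<dagger> ** J ** w x z = mat 1"
    by (simp flip: matrix_mul_assoc)
  then have inv: "w x z ** (J ** (w x (cnj z))\<^sup>\<dagger> ** J) = mat 1"
    by (rule matrix_left_right_inverse[THEN iffD1])
  have "Y x = w x z ** (J ** (w x (cnj z))\<^sup>\<dagger> ** J) ** Y x"
    by (simp only: inv matrix_mul_lid)
  also have "\<dots> = w x z ** J ** ((w x (cnj z))\<^sup>\<dagger> ** J ** Y x)"
    by (simp add: matrix_mul_assoc)
  also have "\<dots> = w x z ** J ** (J ** Y 0)"
    by (simp only: solutions_pairing_constant[OF Y W x]) simp
  finally show ?thesis
    by (simp flip: matrix_mul_assoc)
qed

definition energy_density :: "(real \<Rightarrow> complex^'c^('p + 'p)) \<Rightarrow> real \<Rightarrow> real" where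
  "energy_density Y x = (norm (R ** v0 x ** Y x))\<^sup>2"

text \<open>In the upper half-plane, the indefinite form \<open>Y \<bullet> (J ** Y)\<close> decreases along a solution at a rate
  proportional to the energy density. So integrability of the density amounts to a lower bound for the form.\<close>

lemma energy_identity:
  assumes Y: "solves z Y" and x: "x \<ge> 0"
  shows "((\<lambda>x. Y x \<bullet> (J ** Y x)) has_vector_derivative - (2 * Im z * energy_density Y x)) (at x within {0..})"
proof -
  let ?s = "R ** v0 x ** Y x"
  let ?Y' = "(\<i> * z) \<odot> (J ** H x ** Y x)"
  have JY: "((\<lambda>x. J ** Y x) has_vector_derivative J ** ?Y') (at x within {0..})"
    by (rule has_vector_derivative_eq_rhs, (rule matrix_derivative_intros solvesD[OF Y x])+) simp
  have "((\<lambda>x. Y x \<bullet> (J ** Y x)) has_vector_derivative Y x \<bullet> (J ** ?Y') + ?Y' \<bullet> (J ** Y x))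
      (at x within {0..})"
    by (rule bounded_bilinear.has_vector_derivative[OF bounded_bilinear_inner solvesD[OF Y x] JY])
  also have "?Y' \<bullet> (J ** Y x) = Y x \<bullet> (J ** ?Y')"
    by (simp only: inner_commute[of ?Y'] inner_matrix_mult_left adjoint_J)
  also have "Y x \<bullet> (J ** ?Y') = Y x \<bullet> ((\<i> * z) \<odot> (H x ** Y x))"
    by (simp flip: matrix_mul_assoc)
  also have "\<dots> = - (Im z) * (Y x \<bullet> (H x ** Y x))"
    by (subst inner_cscale_hermitian) (simp_all add: adjoint_H x)
  also have "Y x \<bullet> (H x ** Y x) = energy_density Y x"
    by (simp add: energy_density_def power2_norm_eq_inner inner_matrix_mult_left H x H0_eq adjoint_mult
        flip: matrix_mul_assoc)
  finally show ?thesis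
    by (simp add: mult.assoc)
qed

lemma continuous_on_v0: "continuous_on {0..} v0"
  by (rule continuous_on_vector_derivative[OF v0]) simp

lemma continuous_on_solution: "solves z Y \<Longrightarrow> continuous_on {0..} Y"
  by (rule continuous_on_vector_derivative[OF solvesD]) simp_all

lemma integrable_energy_density_if_energy_bounded_below:
  assumes Y: "solves z Y" and z: "Im z > 0"
    and bound: "\<And>x. x \<ge> 0 \<Longrightarrow> Y x \<bullet> (J ** Y x) \<ge> B"
  shows "energy_density Y integrable_on {0..}"
proof -
  have "(\<lambda>x. 2 * Im z * energy_density Y x) integrable_on {0..}"
    by (rule integrable_if_minus_antiderivative_bounded_below[OF energy_identity[OF Y] _ bound])
      (use z in \<open>auto simp: energy_density_def\<close>)
  from integrable_on_cmult_left[OF this, of "1 / (2 * Im z)"] show ?thesis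
    using z by simp
qed

text \<open>The integrand of a Weyl function is the Gram matrix of \<open>R ** v0 x ** Y x\<close>, for the solution \<open>Y\<close>
  with initial value \<open>above (mat 1) (- \<i> \<odot> \<phi> z)\<close>.\<close>

lemma weyl_integrable_iff:
  "(\<lambda>x. beside (mat 1) (mat \<i> ** (\<phi> z)\<^sup>\<dagger>) ** (w x z)\<^sup>\<dagger> ** H x ** w x z
        ** above (mat 1) (mat (- \<i>) ** \<phi> z)) absolutely_integrable_on {0..}
   \<longleftrightarrow> energy_density (\<lambda>x. w x z ** above (mat 1) (- \<i> \<odot> \<phi> z)) integrable_on {0..}"
proof -
  let ?s = "\<lambda>x. R ** v0 x ** (w x z ** above (mat 1) (- \<i> \<odot> \<phi> z))"
  have "continuous_on {0..} ?s"
    by (intro continuous_intros continuous_on_v0 continuous_on_solution[OF solves_fundamental])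
  note iff = absolutely_integrable_gram_iff[OF this]
  have "beside (mat 1) (mat \<i> ** (\<phi> z)\<^sup>\<dagger>) = (above (mat 1) (- \<i> \<odot> \<phi> z))\<^sup>\<dagger>"
    by (simp add: adjoint_above mat_mult_eq_cscale adjoint_cscale)
  then have "beside (mat 1) (mat \<i> ** (\<phi> z)\<^sup>\<dagger>) ** (w x z)\<^sup>\<dagger> ** H x ** w x z
      ** above (mat 1) (mat (- \<i>) ** \<phi> z) = (?s x)\<^sup>\<dagger> ** ?s x" if "x \<ge> 0" for x
    by (simp add: H that H0_eq adjoint_mult mat_mult_eq_cscale flip: matrix_mul_assoc)
  then have "(\<lambda>x. beside (mat 1) (mat \<i> ** (\<phi> z)\<^sup>\<dagger>) ** (w x z)\<^sup>\<dagger> ** H x ** w x z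
        ** above (mat 1) (mat (- \<i>) ** \<phi> z)) absolutely_integrable_on {0..}
      \<longleftrightarrow> (\<lambda>x. (?s x)\<^sup>\<dagger> ** ?s x) absolutely_integrable_on {0..}"
    by (intro set_integrable_cong) auto
  then show ?thesis
    unfolding iff energy_density_def .
qed

end

section \<open>Explicit solutions\<close>

context explicit_system
begin

lemma Lambda_has_derivative:
  "x \<ge> 0 \<Longrightarrow> (\<Lambda> has_vector_derivative - (\<i> \<odot> (\<alpha> ** \<Lambda> x ** J ** H0 D))) (at x within {0..})"
  using Lambda[of x] by (simp add: mat_mult_eq_cscale cscale_minus_left matrix_mult_minus_left)

text \<open>The Darboux transformation with the data \<open>\<alpha>\<close>, \<open>\<Sigma>\<close>, \<open>\<Lambda>\<close> sends a solution \<open>F\<close> of the system with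
  constant Hamiltonian \<open>H0 D\<close> to \<open>(1 - \<i> J \<Lambda>\<^sup>\<dagger> \<Sigma>\<^sup>-\<^sup>1 (\<alpha> - z)\<^sup>-\<^sup>1 \<Lambda>) F\<close>, which the \<open>J\<close>-unitary gauge \<open>v0\<close> carries
  to a solution of the canonical system. The resolvent does not exist when \<open>z\<close> is an eigenvalue of
  \<open>\<alpha>\<close>; therefore \<open>(\<alpha> - z)\<^sup>-\<^sup>1 \<Lambda> F\<close> is replaced by a function \<open>g\<close> with \<open>(\<alpha> - z) g = \<Lambda> F\<close> and the
  derivative that the resolvent expression would have.\<close>

lemma transformed_solution:
  assumes F: "\<And>x. x \<ge> 0 \<Longrightarrow> (F has_vector_derivative (\<i> * z) \<odot> (J ** H0 D ** F x)) (at x within {0..})"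
    and g: "\<And>x. x \<ge> 0 \<Longrightarrow> (g has_vector_derivative - (\<i> \<odot> (\<Lambda> x ** J ** H0 D ** F x))) (at x within {0..})"
    and alpha_g: "\<And>x. x \<ge> 0 \<Longrightarrow> \<alpha> ** g x = \<Lambda> x ** F x + z \<odot> g x"
  defines "U \<equiv> (\<lambda>x. F x - \<i> \<odot> (J ** (\<Lambda> x)\<^sup>\<dagger> ** S x ** g x))"
  shows "solves z (\<lambda>x. J ** (v0 x)\<^sup>\<dagger> ** J ** U x)"
proof -
  have "((\<lambda>x. J ** (v0 x)\<^sup>\<dagger> ** J ** U x) has_vector_derivative
      (\<i> * z) \<odot> (J ** H x ** (J ** (v0 x)\<^sup>\<dagger> ** J ** U x))) (at x within {0..})" if x: "x \<ge> 0" for x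
  proof -
    let ?q = "q0 D (\<Lambda> x) (\<Sigma> x)"
    have S_alpha': "S x ** (\<alpha> ** A) = \<alpha>\<^sup>\<dagger> ** (S x ** A)
        + \<i> \<odot> (S x ** (\<Lambda> x ** (J ** ((\<Lambda> x)\<^sup>\<dagger> ** (S x ** A)))))" for A :: "complex^'c^'n"
      using arg_cong[OF S_alpha[OF x], of "\<lambda>B. B ** A"]
      by (simp add: matrix_distribs flip: matrix_mul_assoc)
    have Lambda_F: "\<Lambda> x ** F x = \<alpha> ** g x - z \<odot> g x"
      using alpha_g[OF x] by simp
    have U': "(U has_vector_derivative (\<i> * z) \<odot> (J ** H0 D ** U x) - ?q ** U x) (at x within {0..})"
      unfolding U_def
      by (rule has_vector_derivative_eq_rhs, (rule matrix_derivative_intros F g S_has_derivative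
             Lambda_has_derivative x)+)
        (simp add: q0_def matrix_distribs adjoint_simps Lambda_F S_alpha' algebra_simps
          flip: S_def matrix_mul_assoc)
    have v0_J_v0: "v0 x ** (J ** ((v0 x)\<^sup>\<dagger> ** A)) = J ** A" for A :: "complex^'c^('p + 'p)"
      using v0_J_unitary(1)[OF x] by (metis matrix_mul_assoc)
    have q: "?q\<^sup>\<dagger> ** (J ** A) = - (J ** (?q ** A))" for A :: "complex^'c^('p + 'p)"
      using adjoint_q0_J[OF x] by (simp add: matrix_mul_assoc matrix_mult_minus_left)
    show ?thesis
      by (rule has_vector_derivative_eq_rhs, (rule matrix_derivative_intros U' v0 x)+)
        (simp add: H[OF x] matrix_distribs adjoint_simps v0_J_v0 q flip: matrix_mul_assoc)
  qed
  then show ?thesis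
    unfolding solves_def by blast
qed


text \<open>The transformation changes the indefinite form by a term that is nonnegative in the upper
  half-plane. In \<open>U = F - V\<close>, the mixed terms and \<open>V \<bullet> (J ** V)\<close> both contain \<open>h \<bullet> (- \<i> \<odot> (\<alpha> ** \<Sigma> ** h))\<close>,
  by \<open>alpha_g\<close> and by the identity for \<open>\<alpha> ** \<Sigma>\<close> respectively, and these contributions cancel.\<close>

lemma transformed_energy:
  fixes F :: "complex^'c^('p + 'p)"
  assumes alpha_g: "\<alpha> ** g = \<Lambda> x ** F + z \<odot> g" and x: "x \<ge> 0"
  defines "U \<equiv> F - \<i> \<odot> (J ** (\<Lambda> x)\<^sup>\<dagger> ** S x ** g)"
  shows "U \<bullet> (J ** U) = F \<bullet> (J ** F) + 2 * Im z * ((S x ** g) \<bullet> (\<Sigma> x ** (S x ** g)))"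
proof -
  define h where "h = S x ** g"
  define V where "V = \<i> \<odot> (J ** ((\<Lambda> x)\<^sup>\<dagger> ** h))"
  have g: "g = \<Sigma> x ** h"
    by (simp add: h_def matrix_mul_assoc Sigma_S x)
  have U: "U = F - V"
    by (simp add: U_def V_def h_def flip: matrix_mul_assoc)
  have "V \<bullet> (J ** F) = h \<bullet> (- \<i> \<odot> (\<Lambda> x ** F))"
    by (simp add: V_def inner_cscale_left inner_matrix_mult_left)
  also have "\<Lambda> x ** F = \<alpha> ** \<Sigma> x ** h - z \<odot> (\<Sigma> x ** h)"
    using alpha_g by (simp add: g matrix_mul_assoc)
  also have "h \<bullet> (- \<i> \<odot> \<dots>) = h \<bullet> (- \<i> \<odot> (\<alpha> ** \<Sigma> x ** h)) + h \<bullet> ((\<i> * z) \<odot> (\<Sigma> x ** h))"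
    by (simp add: cscale_diff cscale_minus_left inner_diff_right)
  also have "h \<bullet> ((\<i> * z) \<odot> (\<Sigma> x ** h)) = - Im z * (h \<bullet> (\<Sigma> x ** h))"
    by (simp add: inner_cscale_hermitian adjoint_Sigma x)
  finally have VF: "V \<bullet> (J ** F) = h \<bullet> (- \<i> \<odot> (\<alpha> ** \<Sigma> x ** h)) - Im z * (h \<bullet> (\<Sigma> x ** h))"
    by simp
  have FV: "F \<bullet> (J ** V) = V \<bullet> (J ** F)"
    by (simp only: inner_commute[of "F"] inner_matrix_mult_left adjoint_J)
  have "V \<bullet> (J ** V) = h \<bullet> (\<Lambda> x ** J ** (\<Lambda> x)\<^sup>\<dagger> ** h)"
    by (simp add: V_def inner_cscale_left inner_matrix_mult_left flip: matrix_mul_assoc)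
  also have "\<Lambda> x ** J ** (\<Lambda> x)\<^sup>\<dagger> = - \<i> \<odot> (\<alpha> ** \<Sigma> x - \<Sigma> x ** \<alpha>\<^sup>\<dagger>)"
    by (simp add: alpha_Sigma_identity x)
  also have "h \<bullet> (\<dots> ** h) = h \<bullet> (- \<i> \<odot> (\<alpha> ** \<Sigma> x ** h)) + h \<bullet> (\<i> \<odot> (\<Sigma> x ** (\<alpha>\<^sup>\<dagger> ** h)))"
    by (simp add: matrix_distribs inner_diff_right flip: matrix_mul_assoc)
  also have "h \<bullet> (\<i> \<odot> (\<Sigma> x ** (\<alpha>\<^sup>\<dagger> ** h))) = (\<alpha> ** \<Sigma> x ** (- \<i> \<odot> h)) \<bullet> h"
    by (simp only: inner_matrix_mult_left inner_cscale_left adjoint_mult adjoint_Sigma[OF x])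
      (simp flip: matrix_mul_assoc)
  also have "\<dots> = h \<bullet> (- \<i> \<odot> (\<alpha> ** \<Sigma> x ** h))"
    by (simp only: inner_commute cscale_mult_right)
  finally have VV: "V \<bullet> (J ** V) = 2 * (h \<bullet> (- \<i> \<odot> (\<alpha> ** \<Sigma> x ** h)))"
    by simp
  show ?thesis
    unfolding U h_def[symmetric]
    by (simp add: matrix_mult_diff_right inner_diff_left inner_diff_right FV VF VV algebra_simps)
qed

text \<open>A lower bound for the form of \<open>F\<close> is inherited by the transformed solution. The auxiliary function
  \<open>g\<close> is obtained by integration from an initial value \<open>h\<close>; the relation \<open>(\<alpha> - z) g = \<Lambda> F\<close> then holds at
  all points because it holds at \<open>0\<close> and its two sides have equal derivatives.\<close>

lemma integrable_energy_density_transformed: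
  assumes F: "\<And>x. x \<ge> 0 \<Longrightarrow> (F has_vector_derivative (\<i> * z) \<odot> (J ** H0 D ** F x)) (at x within {0..})"
    and h: "\<alpha> ** h = \<Lambda> 0 ** F 0 + z \<odot> h"
    and z: "Im z > 0"
    and bound: "\<And>x. x \<ge> 0 \<Longrightarrow> F x \<bullet> (J ** F x) \<ge> B"
  shows "energy_density (\<lambda>x. w x z ** (F 0 - \<i> \<odot> (J ** (\<Lambda> 0)\<^sup>\<dagger> ** h))) integrable_on {0..}"
proof -
  have cont: "continuous_on {0..} F" "continuous_on {0..} \<Lambda>"
    by (rule continuous_on_vector_derivative[OF F], simp, rule continuous_on_vector_derivative[OF Lambda], simp)
  have "continuous_on {0..} (\<lambda>x. - (\<i> \<odot> (\<Lambda> x ** J ** H0 D ** F x)))"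
    by (intro continuous_intros cont)
  then obtain g where g0: "g 0 = h"
    and g: "\<And>x. x \<ge> 0 \<Longrightarrow> (g has_vector_derivative - (\<i> \<odot> (\<Lambda> x ** J ** H0 D ** F x))) (at x within {0..})"
    using antiderivative_on_half_line by blast
  have alpha_g: "\<alpha> ** g x = \<Lambda> x ** F x + z \<odot> g x" if "x \<ge> 0" for x
  proof -
    have "((\<lambda>x. \<alpha> ** g x - (\<Lambda> x ** F x + z \<odot> g x)) has_vector_derivative 0) (at x within {0..})"
      if "x \<ge> 0" for x
      by (rule has_vector_derivative_eq_rhs,
          (rule matrix_derivative_intros F g Lambda_has_derivative that)+)
        (simp add: matrix_distribs mult.commute flip: matrix_mul_assoc)
    from constant_on_half_line[OF this that] show ?thesis
      by (simp add: g0 h)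
  qed
  define U where "U x = F x - \<i> \<odot> (J ** (\<Lambda> x)\<^sup>\<dagger> ** S x ** g x)" for x
  define Y where "Y x = J ** (v0 x)\<^sup>\<dagger> ** J ** U x" for x
  have Y: "solves z Y"
    unfolding Y_def U_def by (rule transformed_solution[OF F g alpha_g])
  have "Y x \<bullet> (J ** Y x) \<ge> B" if x: "x \<ge> 0" for x
  proof -
    have "Y x \<bullet> (J ** Y x) = U x \<bullet> (J ** (v0 x ** J ** (v0 x)\<^sup>\<dagger>) ** J ** U x)"
      by (simp add: Y_def inner_matrix_mult_left adjoint_mult flip: matrix_mul_assoc)
    also have "\<dots> = U x \<bullet> (J ** U x)"
      by (simp add: v0_J_unitary x)
    also have "\<dots> = F x \<bullet> (J ** F x) + 2 * Im z * ((S x ** g x) \<bullet> (\<Sigma> x ** (S x ** g x)))"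
      unfolding U_def by (rule transformed_energy[OF alpha_g[OF x] x])
    also have "\<dots> \<ge> B"
    proof -
      have "0 \<le> (S x ** g x) \<bullet> (\<Sigma> x ** (S x ** g x))"
        using inner_Sigma_ge[OF x, of "S x ** g x"] by (meson inner_ge_zero order_trans)
      then show ?thesis
        using bound[OF x] z by (simp add: add_increasing2)
    qed
    finally show ?thesis .
  qed
  then have "energy_density Y integrable_on {0..}"
    by (rule integrable_energy_density_if_energy_bounded_below[OF Y z])
  moreover have Y0: "Y 0 = F 0 - \<i> \<odot> (J ** (\<Lambda> 0)\<^sup>\<dagger> ** h)"
  proof -
    have "S 0 = mat 1"
      using Sigma_S(1)[of 0] by (simp add: Sigma0)
    then show ?thesis
      by (simp add: Y_def U_def v0_0 g0)
  qed
  moreover have "energy_density Y x = energy_density (\<lambda>x. w x z ** Y 0) x" if "x \<in> {0..}" for x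
    using solution_eq[OF Y, of x] that by (simp add: energy_density_def)
  ultimately show ?thesis
    using integrable_eq unfolding Y0[symmetric] by blast
qed

end

section \<open>The explicit Weyl functions\<close>

lemma diag_matrix_mult: "diag_matrix a ** diag_matrix b = diag_matrix (\<lambda>i. a i * b i)"
  by (auto simp: vec_eq_iff matrix_matrix_mult_def diag_matrix_def if_distrib[of "\<lambda>x. x * _"] cong: if_cong)

lemma diag_matrix_mult_nth: "(diag_matrix a ** A) $ i $ j = of_real (a i) * A $ i $ j"
  by (simp add: matrix_matrix_mult_def diag_matrix_def if_distrib[of "\<lambda>x. x * _"] cong: if_cong)

lemma diag_matrix_uminus: "diag_matrix (\<lambda>i. - a i) = - diag_matrix a"
  by (simp add: vec_eq_iff diag_matrix_def)

lemma has_vector_derivative_matrixI: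
  fixes f :: "real \<Rightarrow> complex^'c^'r"
  assumes "\<And>i j. ((\<lambda>x. f x $ i $ j) has_vector_derivative f' $ i $ j) (at x within X)"
  shows "(f has_vector_derivative f') (at x within X)"
  using assms unfolding has_vector_derivative_within_iff
  by (intro vec_tendstoI) simp

lemma Psi1_blocks: "Psi1 D L = left_block L + (1/2) *\<^sub>R (right_block L ** D)"
  by (subst beside_left_right_block[of L, symmetric], unfold Psi1_def beside_mult_above)
    (simp add: scaleR_eq_cscale)

text \<open>With \<open>- D\<close> in place of \<open>|D|\<close> the formula for \<open>phi_hat\<close> becomes that for \<open>phi\<close>. Both functions are
  therefore instances of \<open>phi_hat G\<close> with a diagonal \<open>G\<close> whose entries are \<open>\<plusminus> d i\<close>.\<close>

lemma phi_eq_phi_hat: "phi D \<alpha> L = phi_hat (- D) \<alpha> L"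
  and gam_eq_gam_hat: "gam D \<alpha> L = gam_hat (- D) \<alpha> L"
proof -
  have Psi1: "Psi1 D L = Psi1_hat (- D) L"
    by (simp add: Psi1_blocks Psi1_hat_def matrix_mult_minus_right)
  have Psi2: "Psi2 D L = Psi2_hat (- D) L"
    by (simp add: Psi2_def Psi2_hat_def matrix_mult_minus_right)
  show gam: "gam D \<alpha> L = gam_hat (- D) \<alpha> L"
    by (simp add: gam_def gam_hat_def Psi2)
  show "phi D \<alpha> L = phi_hat (- D) \<alpha> L"
    by (rule ext) (simp add: phi_def phi_hat_def gam Psi1 Psi2 mat_mult_eq_cscale
        cscale_minus_left cscale_minus_right)
qed

lemma holomorphic_on_phi_hat:
  "(\<lambda>z. phi_hat G \<alpha> L z $ i $ j) holomorphic_on X" if "X \<inter> matrix_spectrum (gam_hat G \<alpha> L) = {}"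
proof -
  have "phi_hat G \<alpha> L z $ i $ j = (mat (\<i> / 2) ** G) $ i $ j
      + (\<Sum>l\<in>UNIV. (\<Sum>k\<in>UNIV. (Psi1_hat G L)\<^sup>\<dagger> $ i $ k
          * matrix_inv (gam_hat G \<alpha> L - mat z) $ k $ l) * Psi2_hat G L $ l $ j)" for z
    by (simp add: phi_hat_def matrix_matrix_mult_def)
  then show ?thesis
    using holomorphic_on_resolvent[OF that] by (auto intro!: holomorphic_intros)
qed

context explicit_system
begin

lemma gam_hat_identity:
  assumes G: "G\<^sup>\<dagger> = G"
  shows "(gam_hat G \<alpha> (\<Lambda> 0))\<^sup>\<dagger> - gam_hat G \<alpha> (\<Lambda> 0)
         = \<i> \<odot> (right_block (\<Lambda> 0) ** G ** (right_block (\<Lambda> 0))\<^sup>\<dagger>)"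
proof -
  define L1 L2 where "L1 = left_block (\<Lambda> 0)" and "L2 = right_block (\<Lambda> 0)"
  have L: "\<Lambda> 0 = beside L1 L2"
    by (simp add: L1_def L2_def beside_left_right_block)
  have "\<alpha> - \<alpha>\<^sup>\<dagger> = \<i> \<odot> (L1 ** L2\<^sup>\<dagger> + L2 ** L1\<^sup>\<dagger>)"
    using alpha unfolding L
    by (simp add: mat_mult_eq_cscale adjoint_beside J_mult_above beside_mult_above flip: matrix_mul_assoc)
  then have \<alpha>: "\<alpha> = \<alpha>\<^sup>\<dagger> + \<i> \<odot> (L1 ** L2\<^sup>\<dagger> + L2 ** L1\<^sup>\<dagger>)"
    by (simp add: algebra_simps)
  have half: "(\<i>/2) \<odot> A + (\<i>/2) \<odot> A = \<i> \<odot> A" for A :: "complex^'n^'n"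
    by (simp flip: cscale_add_left)
  have "(gam_hat G \<alpha> (\<Lambda> 0))\<^sup>\<dagger> - gam_hat G \<alpha> (\<Lambda> 0)
      = (\<alpha>\<^sup>\<dagger> - \<alpha>) + \<i> \<odot> (L1 ** L2\<^sup>\<dagger> + L2 ** L1\<^sup>\<dagger>)
          + ((\<i>/2) \<odot> (L2 ** G ** L2\<^sup>\<dagger>) + (\<i>/2) \<odot> (L2 ** G ** L2\<^sup>\<dagger>))"
    by (simp add: gam_hat_def Psi2_hat_def mat_mult_eq_cscale scaleR_eq_cscale adjoint_simps
        matrix_distribs G flip: L1_def L2_def matrix_mul_assoc)
  then show ?thesis
    by (subst (asm) (2) \<alpha>) (simp add: half L2_def)
qed

text \<open>An eigenvector \<open>v\<close> for \<open>z\<close> gives \<open>2 * Im z * |v|\<^sup>2 = - v\<^sup>\<dagger> ** L ** G ** L\<^sup>\<dagger> ** v\<close>, with \<open>L\<close> the right block of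
  \<open>\<Lambda> 0\<close>, by the identity for the skew part of \<open>gam_hat\<close>; the right side is at most \<open>0\<close>.\<close>

lemma spectrum_gam_hat_nonneg:
  assumes g: "\<And>i. g i \<ge> 0"
  shows "matrix_spectrum (gam_hat (diag_matrix g) \<alpha> (\<Lambda> 0)) \<inter> \<complex>\<^sub>+ = {}"
proof -
  let ?\<gamma> = "gam_hat (diag_matrix g) \<alpha> (\<Lambda> 0)" and ?L = "right_block (\<Lambda> 0)"
  have "invertible (?\<gamma> - mat z)" if z: "Im z > 0" for z
  proof (rule invertible_if_no_kernel)
    fix A :: "complex^'n^'n"
    assume "(?\<gamma> - mat z) ** A = 0"
    then have A: "?\<gamma> ** A = z \<odot> A"
      by (simp add: matrix_mult_diff_left mat_mult_eq_cscale)
    have mat1: "(mat 1 :: complex^'n^'n)\<^sup>\<dagger> = mat 1"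
      by simp
    have re: "A \<bullet> (c \<odot> A) = Re c * (A \<bullet> A)" for c
      using inner_cscale_hermitian[OF mat1, of A c] by simp
    have "A \<bullet> (\<i> \<odot> (?\<gamma>\<^sup>\<dagger> ** A)) = (?\<gamma> ** A) \<bullet> (\<i> \<odot> A)"
      by (simp add: inner_matrix_mult_left)
    also have "\<dots> = A \<bullet> ((cnj z * \<i>) \<odot> A)"
      by (simp add: A inner_cscale_left)
    finally have "A \<bullet> (\<i> \<odot> ((?\<gamma>\<^sup>\<dagger> - ?\<gamma>) ** A)) = 2 * Im z * (A \<bullet> A)"
      by (simp add: matrix_mult_diff_left cscale_diff inner_diff_right A re)
    moreover have "A \<bullet> (\<i> \<odot> ((?\<gamma>\<^sup>\<dagger> - ?\<gamma>) ** A)) = - ((?L\<^sup>\<dagger> ** A) \<bullet> (diag_matrix g ** (?L\<^sup>\<dagger> ** A)))"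
      by (simp add: gam_hat_identity inner_matrix_mult_left cscale_minus_left flip: matrix_mul_assoc)
    moreover have nonneg: "0 \<le> B \<bullet> (diag_matrix g ** B)" for B :: "complex^'n^'p"
      unfolding inner_matrix
      by (intro sum_nonneg) (use g in \<open>auto simp: diag_matrix_mult_nth algebra_simps intro!: add_nonneg_nonneg\<close>)
    ultimately have "2 * Im z * (A \<bullet> A) \<le> 0"
      using nonneg[of "?L\<^sup>\<dagger> ** A"] by linarith
    then have "A \<bullet> A \<le> 0"
      using z by (simp add: mult_le_0_iff)
    then show "A = 0"
      by (metis inner_eq_zero_iff inner_ge_zero order_antisym)
  qed
  then show ?thesis
    by (auto simp: matrix_spectrum_def upper_half_plane_def)
qed

text \<open>The constant-coefficient system has the eigenvectors \<open>\<kappa> = above 1 (G / 2)\<close>: \<open>(d i)\<^sup>2 = (g i)\<^sup>2\<close> makes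
  \<open>J ** H0 D ** \<kappa> = \<kappa> ** P\<close> with \<open>P = (D + G) / 2\<close>, and \<open>P \<ge> 0\<close> makes \<open>exp (\<i> z x P)\<close> bounded in the upper
  half-plane. So \<open>F x = \<kappa> ** exp (\<i> z x P) ** c\<close> has a form bounded below, and the transformed solution
  has integrable energy. The equations \<open>(\<alpha> - z) h = \<Lambda> 0 ** \<kappa> ** c\<close> and \<open>c = 1 + \<i> L2\<^sup>\<dagger> h\<close>, the latter
  being the requirement that the upper block of the initial value is \<open>1\<close>, combine to
  \<open>(gam_hat G - z) h = Psi2_hat G\<close>; the lower block is then \<open>- \<i> phi_hat G\<close>.\<close>

lemma weyl_integrable_explicit:
  assumes g: "\<And>i. (g i)\<^sup>2 = (d i)\<^sup>2" "\<And>i. d i + g i \<ge> 0"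
    and z: "Im z > 0" and inv: "invertible (gam_hat (diag_matrix g) \<alpha> (\<Lambda> 0) - mat z)"
  shows "energy_density (\<lambda>x. w x z ** above (mat 1) (- \<i> \<odot> phi_hat (diag_matrix g) \<alpha> (\<Lambda> 0) z))
           integrable_on {0..}"
proof -
  define L1 L2 where "L1 = left_block (\<Lambda> 0)" and "L2 = right_block (\<Lambda> 0)"
  have L: "\<Lambda> 0 = beside L1 L2"
    by (simp add: L1_def L2_def beside_left_right_block)
  define G where "G = diag_matrix g"
  define p where "p i = (d i + g i) / 2" for i
  define \<kappa> :: "complex^'p^('p + 'p)" where "\<kappa> = above (mat 1) ((1/2) \<odot> G)"
  define X :: "real \<Rightarrow> complex^'p^'p" where
    "X x = (\<chi> i j. if i = j then exp (\<i> * z * p i * x) else 0)" for x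
  define h where "h = matrix_inv (gam_hat G \<alpha> (\<Lambda> 0) - mat z) ** Psi2_hat G (\<Lambda> 0)"
  define c where "c = mat 1 + \<i> \<odot> (L2\<^sup>\<dagger> ** h)"
  define F where "F x = \<kappa> ** (X x ** c)" for x
  have adjoint_G: "G\<^sup>\<dagger> = G"
    by (simp add: G_def)

  have X': "(X has_vector_derivative (\<i> * z) \<odot> (diag_matrix p ** X x)) (at x within {0..})" for x
  proof (rule has_vector_derivative_matrixI)
    fix i j
    have "((\<lambda>x. exp (\<i> * z * p i * complex_of_real x)) has_vector_derivative
        \<i> * z * p i * exp (\<i> * z * p i * x)) (at x within {0..})"
      by (rule has_vector_derivative_real_field) (auto intro!: derivative_eq_intros)
    then show "((\<lambda>x. X x $ i $ j) has_vector_derivative ((\<i> * z) \<odot> (diag_matrix p ** X x)) $ i $ j)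
        (at x within {0..})"
      by (cases "i = j") (simp_all add: X_def diag_matrix_mult_nth mult_ac)
  qed
  have "G ** diag_matrix p = D ** diag_matrix p"
  proof -
    have "g i * p i = d i * p i" for i
      using g(1)[of i] unfolding p_def by (simp only: power2_eq_square) algebra
    then show ?thesis
      unfolding G_def D diag_matrix_mult by presburger
  qed
  moreover have "R ** \<kappa> = diag_matrix p"
  proof -
    have "R ** \<kappa> = (1/2) \<odot> (D + G)"
      by (simp add: R_def \<kappa>_def beside_mult_above scaleR_eq_cscale cscale_add)
    also have "\<dots> = diag_matrix p"
      by (simp add: vec_eq_iff D G_def diag_matrix_def p_def)
    finally show ?thesis .
  qed
  ultimately have eigen: "J ** H0 D ** \<kappa> = \<kappa> ** diag_matrix p"
    by (simp add: H0_eq adjoint_R J_mult_above above_mult \<kappa>_def scaleR_eq_cscale flip: matrix_mul_assoc)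
  have F': "(F has_vector_derivative (\<i> * z) \<odot> (J ** H0 D ** F x)) (at x within {0..})" for x
  proof -
    have "(F has_vector_derivative \<kappa> ** ((\<i> * z) \<odot> (diag_matrix p ** X x) ** c)) (at x within {0..})"
      unfolding F_def
      by (rule has_vector_derivative_eq_rhs, (rule matrix_derivative_intros X')+) simp
    also have "\<kappa> ** ((\<i> * z) \<odot> (diag_matrix p ** X x) ** c) = (\<i> * z) \<odot> (J ** H0 D ** \<kappa> ** (X x ** c))"
      by (simp add: eigen matrix_mul_assoc)
    finally show ?thesis
      by (simp add: F_def[abs_def] matrix_mul_assoc)
  qed

  have bound: "F x \<bullet> (J ** F x) \<ge> - (\<Sum>i\<in>UNIV. \<Sum>j\<in>UNIV. \<bar>g i\<bar> * (cmod (c $ i $ j))\<^sup>2)"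
    if x: "x \<ge> 0" for x
  proof -
    have X_nth: "(X x ** c) $ i $ j = exp (\<i> * z * p i * x) * c $ i $ j" for i j
      by (simp add: X_def matrix_matrix_mult_def if_distrib[of "\<lambda>x. x * _"] cong: if_cong)
    have "\<kappa>\<^sup>\<dagger> ** J ** \<kappa> = G"
      by (simp add: \<kappa>_def adjoint_above adjoint_cscale adjoint_G J_mult_above beside_mult_above
          flip: matrix_mul_assoc cscale_add_left)
    then have "\<kappa>\<^sup>\<dagger> ** (J ** (\<kappa> ** A)) = G ** A" for A :: "complex^'p^'p"
      by (simp add: matrix_mul_assoc)
    then have "F x \<bullet> (J ** F x) = (X x ** c) \<bullet> (G ** (X x ** c))"
      unfolding F_def inner_matrix_mult_left[of \<kappa>] by simp
    also have "\<dots> = (\<Sum>i\<in>UNIV. \<Sum>j\<in>UNIV. g i * (cmod ((X x ** c) $ i $ j))\<^sup>2)"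
    proof -
      have "Re (cnj u * (complex_of_real r * u)) = r * (cmod u)\<^sup>2" for u r
        unfolding cmod_power2 by (simp add: power2_eq_square algebra_simps)
      then show ?thesis
        by (simp only: inner_matrix G_def diag_matrix_mult_nth)
    qed
    also have "\<dots> \<ge> (\<Sum>i\<in>UNIV. \<Sum>j\<in>UNIV. - (\<bar>g i\<bar> * (cmod (c $ i $ j))\<^sup>2))"
    proof (intro sum_mono)
      fix i j
      have "cmod ((X x ** c) $ i $ j) \<le> cmod (c $ i $ j)"
        using z x g(2)[of i] by (simp add: X_nth norm_mult p_def mult_left_le_one_le)
      then have "\<bar>g i\<bar> * (cmod ((X x ** c) $ i $ j))\<^sup>2 \<le> \<bar>g i\<bar> * (cmod (c $ i $ j))\<^sup>2"
        by (intro mult_left_mono power_mono) auto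
      moreover have "- \<bar>g i\<bar> * (cmod ((X x ** c) $ i $ j))\<^sup>2 \<le> g i * (cmod ((X x ** c) $ i $ j))\<^sup>2"
        by (intro mult_right_mono) auto
      ultimately show "- (\<bar>g i\<bar> * (cmod (c $ i $ j))\<^sup>2) \<le> g i * (cmod ((X x ** c) $ i $ j))\<^sup>2"
        by simp
    qed
    finally show ?thesis
      by (simp add: sum_negf)
  qed

  have F0: "F 0 = \<kappa> ** c"
  proof -
    have "X 0 = mat 1"
      by (simp add: vec_eq_iff X_def mat_def)
    then show ?thesis
      by (simp add: F_def)
  qed
  have "(gam_hat G \<alpha> (\<Lambda> 0) - mat z) ** h = Psi2_hat G (\<Lambda> 0)"
    using matrix_inv_mult(1)[OF inv] by (simp add: h_def G_def matrix_mul_assoc)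
  then have "\<alpha> ** h = Psi2_hat G (\<Lambda> 0) ** c + z \<odot> h"
    by (simp add: gam_hat_def c_def matrix_distribs mat_mult_eq_cscale algebra_simps flip: matrix_mul_assoc L2_def)
  moreover have "Psi2_hat G (\<Lambda> 0) = \<Lambda> 0 ** \<kappa>"
    unfolding Psi2_hat_def \<kappa>_def L1_def[symmetric] L2_def[symmetric] 
    by (simp add: L beside_mult_above scaleR_eq_cscale)
  ultimately have h: "\<alpha> ** h = \<Lambda> 0 ** F 0 + z \<odot> h"
    by (simp add: F0 matrix_mul_assoc)
  have "above (mat 1) (- \<i> \<odot> phi_hat G \<alpha> (\<Lambda> 0) z) = F 0 - \<i> \<odot> (J ** (\<Lambda> 0)\<^sup>\<dagger> ** h)"
  proof -
    have "phi_hat G \<alpha> (\<Lambda> 0) z = (\<i> / 2) \<odot> G + (Psi1_hat G (\<Lambda> 0))\<^sup>\<dagger> ** h"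
      by (simp add: phi_hat_def h_def mat_mult_eq_cscale matrix_mul_assoc)
    also have "(Psi1_hat G (\<Lambda> 0))\<^sup>\<dagger> = L1\<^sup>\<dagger> - (1/2) \<odot> (G ** L2\<^sup>\<dagger>)"
      by (simp add: Psi1_hat_def scaleR_eq_cscale adjoint_simps adjoint_G flip: L1_def L2_def)
    finally have "- \<i> \<odot> phi_hat G \<alpha> (\<Lambda> 0) z = (1/2) \<odot> (G ** c) - \<i> \<odot> (L1\<^sup>\<dagger> ** h)"
      by (simp add: c_def matrix_distribs matrix_mul_assoc)
    then show ?thesis
      unfolding L
      by (simp add: F0 \<kappa>_def above_mult adjoint_beside J_mult_above cscale_above above_diff)
        (simp add: c_def)
  qed
  then show ?thesis
    using integrable_energy_density_transformed[OF F' h z bound] by (simp add: G_def)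
qed

lemma weyl_function_phi_hat:
  assumes "\<And>i. (g i)\<^sup>2 = (d i)\<^sup>2" "\<And>i. d i + g i \<ge> 0"
  shows "weyl_function H w (matrix_spectrum (gam_hat (diag_matrix g) \<alpha> (\<Lambda> 0)))
           (phi_hat (diag_matrix g) \<alpha> (\<Lambda> 0))"
proof -
  have "(matrix_spectrum (gam_hat (diag_matrix g) \<alpha> (\<Lambda> 0))) sparse_in \<complex>\<^sub>+"
    by (rule finite_imp_sparse[OF finite_matrix_spectrum])
  moreover have "Im z > 0 \<and> invertible (gam_hat (diag_matrix g) \<alpha> (\<Lambda> 0) - mat z)"
    if "z \<in> \<complex>\<^sub>+ - matrix_spectrum (gam_hat (diag_matrix g) \<alpha> (\<Lambda> 0))" for z
    using that by (simp add: matrix_spectrum_def upper_half_plane_def)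
  ultimately show ?thesis
    unfolding weyl_function_def weyl_integrable_iff
    using weyl_integrable_explicit[OF assms] holomorphic_on_phi_hat by blast
qed

end

section \<open>Uniqueness for negative \<open>D\<close>\<close>

lemma weyl_function_no_singularities:
  assumes "weyl_function H w X \<phi>" "X \<inter> \<complex>\<^sub>+ = {}"
  shows "weyl_function H w {} \<phi>"
proof -
  have "\<complex>\<^sub>+ - X = \<complex>\<^sub>+ - {}"
    using assms(2) by blast
  then show ?thesis
    using assms(1) unfolding weyl_function_def by simp
qed

lemma det_diag_matrix: "det (diag_matrix a) = (\<Prod>i\<in>UNIV. of_real (a i))"
  by (subst det_diagonal) (simp_all add: diag_matrix_def)

lemma negative_definite_diag_matrix:
  assumes "negative_definite (diag_matrix d)"
  shows "d i < 0"
proof -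
  have "axis i (1 :: complex) \<noteq> 0"
    by (simp add: axis_eq_0_iff)
  then have "Re (\<Sum>k\<in>UNIV. cnj (axis i 1 $ k) * (diag_matrix d *v axis i 1) $ k) < 0"
    using assms unfolding negative_definite_def by blast
  moreover have "cnj (axis i 1 $ k) * (diag_matrix d *v axis i 1) $ k = (if k = i then of_real (d i) else 0)" for k
    by (auto simp: axis_def matrix_vector_mult_def diag_matrix_def if_distrib[of "\<lambda>x. _ * x"] cong: if_cong)
  ultimately show ?thesis
    by simp
qed

context explicit_system
begin

lemma Psi2_constant:
  assumes "x \<ge> 0"
  shows "Psi2 D (\<Lambda> x) = Psi2 D (\<Lambda> 0)"
proof -
  define \<kappa> :: "complex^'p^('p + 'p)" where "\<kappa> = above (mat 1) (- ((1/2) *\<^sub>R D))"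
  have Psi2: "Psi2 D L = L ** \<kappa>" for L
    by (subst (2) beside_left_right_block[of L, symmetric])
      (simp add: Psi2_def \<kappa>_def beside_mult_above matrix_mult_minus_right scaleR_eq_cscale)
  have "R ** \<kappa> = 0"
    by (simp add: R_def \<kappa>_def beside_mult_above)
  then have "((\<lambda>x. \<Lambda> x ** \<kappa>) has_vector_derivative 0) (at x within {0..})" if "x \<ge> 0" for x
    by (intro has_vector_derivative_eq_rhs[OF has_vector_derivative_matrix_mult[OF
          Lambda_has_derivative[OF that] has_vector_derivative_const]])
      (simp add: H0_eq matrix_mult_minus_left flip: matrix_mul_assoc)
  from constant_on_half_line[OF this assms] show ?thesis
    by (simp add: Psi2)
qed

text \<open>For \<open>D < 0\<close> the form is bounded below by a multiple of the energy density, by completing a square: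
  if \<open>s = D U1 / 2 + U2\<close> is the image under \<open>R\<close>, then \<open>U \<bullet> (J ** U) = 2 U1 \<bullet> s + U1 \<bullet> (- D U1)\<close>.\<close>

lemma energy_ge_density:
  assumes d: "\<And>i. d i < 0"
  obtains C where "C > 0"
    "\<And>x (Y :: real \<Rightarrow> complex^'c^('p + 'p)). x \<ge> 0 \<Longrightarrow> Y x \<bullet> (J ** Y x) \<ge> - (C * energy_density Y x)"
proof -
  define K K' where "K = diag_matrix (\<lambda>i. sqrt (- d i))" and "K' = diag_matrix (\<lambda>i. 1 / sqrt (- d i))"
  have sqrt: "sqrt (- d i) * sqrt (- d i) = - d i" "sqrt (- d i) * (1 / sqrt (- d i)) = 1" for i
    using d[of i] by (auto simp: real_sqrt_mult[symmetric])
  have KK: "K ** K = - D"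
    unfolding K_def diag_matrix_mult sqrt by (simp add: D diag_matrix_uminus)
  have KK': "K ** K' = mat 1"
    unfolding K_def K'_def diag_matrix_mult sqrt by (simp add: vec_eq_iff diag_matrix_def mat_def)
  have adjoint_K: "K\<^sup>\<dagger> = K"
    by (simp add: K_def)
  obtain C where C: "C > 0" "\<And>B :: complex^'c^'p. norm (K' ** B) \<le> norm B * C"
    using bounded_linear.pos_bounded[OF
        bounded_bilinear.bounded_linear_right[OF bounded_bilinear_matrix_mult, of K']] by blast
  have bound: "U \<bullet> (J ** U) \<ge> - (C\<^sup>2 * (norm (R ** U))\<^sup>2)" for U :: "complex^'c^('p + 'p)"
  proof -
    define U1 U2 where "U1 = (\<chi> k. U $ Inl k)" and "U2 = (\<chi> k. U $ Inr k)"
    have U: "U = above U1 U2"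
      by (rule above_eqI) (simp_all add: U1_def U2_def)
    define s where "s = R ** U"
    have s: "s = (1/2) *\<^sub>R (D ** U1) + U2"
      by (simp add: s_def U R_def beside_mult_above scaleR_eq_cscale)
    have "U \<bullet> (J ** U) = 2 * (U1 \<bullet> U2)"
      unfolding U J_mult_above by (simp add: inner_vec_def[of "above _ _"] sum_UNIV_sum inner_commute)
        (simp add: inner_vec_def[of U1])
    also have "\<dots> = 2 * (U1 \<bullet> s) - U1 \<bullet> (D ** U1)"
      by (simp add: s inner_add_right)
    also have "\<dots> = (K ** U1 + K' ** s) \<bullet> (K ** U1 + K' ** s) - (K' ** s) \<bullet> (K' ** s)"
    proof -
      have "(K ** U1) \<bullet> (K ** U1) = - (U1 \<bullet> (D ** U1))"
        by (simp add: inner_matrix_mult_left adjoint_K matrix_mul_assoc KK matrix_mult_minus_left)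
      moreover have "(K ** U1) \<bullet> (K' ** s) = U1 \<bullet> s"
        by (simp add: inner_matrix_mult_left[of K] adjoint_K matrix_mul_assoc KK')
      ultimately show ?thesis
        by (simp add: inner_add_left inner_add_right inner_commute)
    qed
    also have "\<dots> \<ge> - ((K' ** s) \<bullet> (K' ** s))"
      by simp
    also have "- ((K' ** s) \<bullet> (K' ** s)) \<ge> - (C\<^sup>2 * (norm s)\<^sup>2)"
      using power_mono[OF C(2)[of s], of 2] by (simp add: power2_norm_eq_inner power_mult_distrib mult.commute)
    finally show ?thesis
      by (simp add: s_def)
  qed
  have "Y x \<bullet> (J ** Y x) \<ge> - (C\<^sup>2 * energy_density Y x)" if "x \<ge> 0"
    for x and Y :: "real \<Rightarrow> complex^'c^('p + 'p)"
  proof -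
    have "Y x \<bullet> (J ** Y x) = (v0 x ** Y x) \<bullet> (J ** (v0 x ** Y x))"
      using v0_J_unitary(2)[OF that] by (simp add: inner_matrix_mult_left matrix_mul_assoc)
    then show ?thesis
      using bound[of "v0 x ** Y x"] by (simp add: energy_density_def matrix_mul_assoc)
  qed
  then show thesis
    using C(1) by (intro that[of "C\<^sup>2"]) auto
qed

text \<open>The difference of the two solutions starts at \<open>above 0 N\<close>, where the form vanishes. If \<open>N \<noteq> 0\<close>, then
  the form decreases strictly at the start, so it is eventually below a negative constant. By the
  preceding bound the energy density then stays away from \<open>0\<close>, so that it is not integrable.\<close>

lemma weyl_matrix_unique:
  assumes d: "\<And>i. d i < 0" and z: "Im z > 0"
    and A: "energy_density (\<lambda>x. w x z ** above (mat 1) (- \<i> \<odot> A)) integrable_on {0..}"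
    and B: "energy_density (\<lambda>x. w x z ** above (mat 1) (- \<i> \<odot> B)) integrable_on {0..}"
  shows "A = B"
proof (rule ccontr)
  let ?YA = "\<lambda>x. w x z ** above (mat 1) (- \<i> \<odot> A)" and ?YB = "\<lambda>x. w x z ** above (mat 1) (- \<i> \<odot> B)"
  assume "A \<noteq> B"
  define N where "N = (- \<i>) \<odot> A - (- \<i>) \<odot> B"
  have "N \<noteq> 0"
    using \<open>A \<noteq> B\<close> by (simp add: N_def vec_eq_iff) metis
  define Y where "Y x = w x z ** above 0 N" for x
  define T where "T x = Y x \<bullet> (J ** Y x)" for x
  have Y: "solves z Y"
    unfolding Y_def by (rule solves_fundamental)
  have Y_diff: "Y x = ?YA x - ?YB x" for x
    by (simp add: Y_def N_def above_diff flip: matrix_mult_diff_right)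
  have density_le: "energy_density Y x \<le> 2 * energy_density ?YA x + 2 * energy_density ?YB x" for x
  proof -
    have "(norm (a - b))\<^sup>2 \<le> 2 * (norm a)\<^sup>2 + 2 * (norm b)\<^sup>2" for a b :: "complex^'p^'p"
      using zero_le_power2[of "norm (a + b)"]
      by (simp add: power2_norm_eq_inner inner_add_left inner_add_right inner_diff_left inner_diff_right inner_commute)
    then show ?thesis
      unfolding energy_density_def Y_diff matrix_mult_diff_right .
  qed
  have T': "(T has_vector_derivative - (2 * Im z * energy_density Y x)) (at x within {0..})" if "x \<ge> 0" for x
    using energy_identity[OF Y that] by (simp add: T_def[abs_def])
  have T0: "T 0 = 0"
    by (simp add: T_def Y_def J_mult_above inner_vec_def[of "above _ _"] sum_UNIV_sum)
  have density_0: "energy_density Y 0 = (norm N)\<^sup>2"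
    by (simp add: energy_density_def Y_def v0_0 R_def beside_mult_above)
  obtain a where a: "a \<ge> 0" "T a < 0"
  proof (rule ccontr)
    assume "\<not> thesis"
    then have nonneg: "T y \<ge> 0" if "y \<ge> 0" for y
      using that \<open>\<And>a. a \<ge> 0 \<Longrightarrow> T a < 0 \<Longrightarrow> thesis\<close> by force
    have "((\<lambda>y. (T y - T 0) /\<^sub>R (y - 0)) \<longlongrightarrow> - (2 * Im z * energy_density Y 0)) (at 0 within {0..})"
      using T'[of 0] unfolding has_vector_derivative_within_iff by simp
    moreover have "\<forall>\<^sub>F y in at 0 within {0..}. 0 \<le> (T y - T 0) /\<^sub>R (y - 0)"
      using nonneg by (auto simp: eventually_at_filter T0)
    moreover have "at (0::real) within {0..} \<noteq> bot"
    proof -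
      have "{0..} - {0} = {0 :: real<..}"
        by auto
      then show ?thesis
        by (simp add: at_within_eq_bot_iff)
    qed
    ultimately have "0 \<le> - (2 * Im z * energy_density Y 0)"
      by (rule tendsto_lowerbound)
    then show False
      using z \<open>N \<noteq> 0\<close> by (simp add: density_0 mult_le_0_iff)
  qed
  obtain C where C: "C > 0"
    "\<And>x (Y :: real \<Rightarrow> complex^'p^('p + 'p)). x \<ge> 0 \<Longrightarrow> Y x \<bullet> (J ** Y x) \<ge> - (C * energy_density Y x)"
    using energy_ge_density[OF d] by blast
  have "energy_density Y x \<ge> - T a / C" if "x \<ge> a" for x
  proof -
    have "- T a \<le> - T x"
    proof -
      have "((\<lambda>x. - T x) has_vector_derivative 2 * Im z * energy_density Y y) (at y within {0..})"
        if "y \<ge> 0" for y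
        using has_vector_derivative_minus[OF T'[OF that]] by simp
      then show ?thesis
        by (rule nonneg_derivative_ge_initial) (use z that a in \<open>auto simp: energy_density_def\<close>)
    qed
    also have "\<dots> \<le> C * energy_density Y x"
      using C(2)[of x Y] that a by (simp add: T_def)
    finally show ?thesis
      using C(1) by (subst pos_divide_le_eq) (simp_all add: mult.commute)
  qed
  then have away: "- T a / C \<le> 2 * energy_density ?YA x + 2 * energy_density ?YB x" if "x \<ge> a" for x
    using density_le[of x] that order_trans by blast
  have int: "(\<lambda>x. 2 * energy_density ?YA x + 2 * energy_density ?YB x) integrable_on {0..}"
    using integrable_add[OF integrable_on_cmult_left[OF A, of 2] integrable_on_cmult_left[OF B, of 2]] by simp
  show False
    by (rule not_integrable_if_bounded_away[OF int _ _ a(1) away])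
      (use a C(1) in \<open>auto simp: energy_density_def divide_neg_pos\<close>)
qed

end

theorem proposition3p4:
  fixes d :: "'p::finite \<Rightarrow> real"
    and D E :: "complex^'p^'p"
    and \<alpha> :: "complex^'n^'n"
    and \<Lambda> :: "real \<Rightarrow> complex^('p + 'p)^'n"
    and \<Sigma> :: "real \<Rightarrow> complex^'n^'n"
    and v0 H :: "real \<Rightarrow> complex^('p + 'p)^('p + 'p)"
    and w :: "real \<Rightarrow> complex \<Rightarrow> complex^('p + 'p)^('p + 'p)"
  assumes D: "D = diag_matrix d" "det D \<noteq> 0"
    and E: "E = diag_matrix (\<lambda>i. \<bar>d i\<bar>)"
    and alpha: "\<alpha> - \<alpha>\<^sup>\<dagger> = mat \<i> ** \<Lambda> 0 ** J ** (\<Lambda> 0)\<^sup>\<dagger>"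
    and Lambda: "\<And>x. x \<ge> 0 \<Longrightarrow>
      (\<Lambda> has_vector_derivative mat (- \<i>) ** \<alpha> ** \<Lambda> x ** J ** H0 D) (at x within {0..})"
    and Sigma0: "\<Sigma> 0 = mat 1"
    and Sigma: "\<And>x. x \<ge> 0 \<Longrightarrow>
      (\<Sigma> has_vector_derivative Psi1 D (\<Lambda> x) ** (Psi1 D (\<Lambda> x))\<^sup>\<dagger>) (at x within {0..})"
    and v0_0: "v0 0 = mat 1"
    and v0: "\<And>x. x \<ge> 0 \<Longrightarrow>
      (v0 has_vector_derivative - (q0 D (\<Lambda> x) (\<Sigma> x) ** v0 x)) (at x within {0..})"
    and H: "\<And>x. x \<ge> 0 \<Longrightarrow> H x = (v0 x)\<^sup>\<dagger> ** H0 D ** v0 x"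
    and w: "fundamental_solution H w"
  shows
    "Psi1 D (\<Lambda> 0) = left_block (\<Lambda> 0) + (1/2) *\<^sub>R (right_block (\<Lambda> 0) ** D)
     \<and> (\<forall>x\<ge>0. Psi2 D (\<Lambda> x) = Psi2 D (\<Lambda> 0))
     \<and> weyl_function H w (matrix_spectrum (gam D \<alpha> (\<Lambda> 0))) (phi D \<alpha> (\<Lambda> 0))
     \<and> weyl_function H w {} (phi_hat E \<alpha> (\<Lambda> 0))
     \<and> (negative_definite D \<longrightarrow>
          phi D \<alpha> (\<Lambda> 0) = phi_hat E \<alpha> (\<Lambda> 0)
          \<and> weyl_function H w {} (phi D \<alpha> (\<Lambda> 0))
          \<and> (\<forall>S \<psi>. weyl_function H w S \<psi> \<longrightarrow> (\<forall>z \<in> \<complex>\<^sub>+ - S. \<psi> z = phi D \<alpha> (\<Lambda> 0) z)))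
     \<and> gam D \<alpha> (\<Lambda> 0) - (gam D \<alpha> (\<Lambda> 0))\<^sup>\<dagger>
         = mat \<i> ** right_block (\<Lambda> 0) ** D ** (right_block (\<Lambda> 0))\<^sup>\<dagger>
     \<and> (gam_hat E \<alpha> (\<Lambda> 0))\<^sup>\<dagger> - gam_hat E \<alpha> (\<Lambda> 0)
         = mat \<i> ** (Psi2_hat E (\<Lambda> 0) - Psi1_hat E (\<Lambda> 0)) ** matrix_inv E
             ** (Psi2_hat E (\<Lambda> 0) - Psi1_hat E (\<Lambda> 0))\<^sup>\<dagger>
     \<and> (negative_definite D \<longrightarrow>
          matrix_spectrum (gam D \<alpha> (\<Lambda> 0)) \<inter> \<complex>\<^sub>+ = {}
          \<and> (\<forall>i j. (\<lambda>z. phi D \<alpha> (\<Lambda> 0) z $ i $ j) holomorphic_on \<complex>\<^sub>+))"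
proof -
  have d_nonzero: "d i \<noteq> 0" for i
    using D by (auto simp: det_diag_matrix)
  interpret explicit_system d D \<alpha> \<Lambda> \<Sigma> v0 H w
    by unfold_locales (fact D(1) alpha Lambda Sigma0 Sigma v0_0 v0 H w)+
  let ?L = "right_block (\<Lambda> 0)"
  have minus_D: "- D = diag_matrix (\<lambda>i. - d i)"
    by (simp add: D diag_matrix_uminus)
  have adjoint_E: "E\<^sup>\<dagger> = E"
    by (simp add: E)
  have weyl_phi: "weyl_function H w (matrix_spectrum (gam D \<alpha> (\<Lambda> 0))) (phi D \<alpha> (\<Lambda> 0))"
    unfolding phi_eq_phi_hat gam_eq_gam_hat minus_D by (rule weyl_function_phi_hat) simp_all
  have no_spectrum: "matrix_spectrum (gam_hat E \<alpha> (\<Lambda> 0)) \<inter> \<complex>\<^sub>+ = {}"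
    unfolding E by (rule spectrum_gam_hat_nonneg) simp
  have "weyl_function H w (matrix_spectrum (gam_hat E \<alpha> (\<Lambda> 0))) (phi_hat E \<alpha> (\<Lambda> 0))"
    unfolding E by (rule weyl_function_phi_hat) (simp_all add: abs_if)
  then have weyl_phi_hat: "weyl_function H w {} (phi_hat E \<alpha> (\<Lambda> 0))"
    using no_spectrum by (rule weyl_function_no_singularities)
  have gam: "gam D \<alpha> (\<Lambda> 0) - (gam D \<alpha> (\<Lambda> 0))\<^sup>\<dagger> = mat \<i> ** ?L ** D ** ?L\<^sup>\<dagger>"
  proof -
    have "(gam D \<alpha> (\<Lambda> 0))\<^sup>\<dagger> - gam D \<alpha> (\<Lambda> 0) = - (mat \<i> ** ?L ** D ** ?L\<^sup>\<dagger>)"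
      unfolding gam_eq_gam_hat
      by (subst gam_hat_identity) (simp_all add: adjoint_minus mat_mult_eq_cscale matrix_distribs)
    then show ?thesis
      by (simp add: algebra_simps)
  qed
  have gam_hat: "(gam_hat E \<alpha> (\<Lambda> 0))\<^sup>\<dagger> - gam_hat E \<alpha> (\<Lambda> 0)
         = mat \<i> ** (Psi2_hat E (\<Lambda> 0) - Psi1_hat E (\<Lambda> 0)) ** matrix_inv E
             ** (Psi2_hat E (\<Lambda> 0) - Psi1_hat E (\<Lambda> 0))\<^sup>\<dagger>"
  proof -
    have "invertible E"
      by (simp add: invertible_det_nz E det_diag_matrix d_nonzero)
    have diff: "Psi2_hat E (\<Lambda> 0) - Psi1_hat E (\<Lambda> 0) = ?L ** E"
      by (simp add: Psi2_hat_def Psi1_hat_def flip: scaleR_add_left)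
    have "mat \<i> ** (?L ** E) ** matrix_inv E ** (?L ** E)\<^sup>\<dagger> = \<i> \<odot> (?L ** (E ** matrix_inv E) ** E ** ?L\<^sup>\<dagger>)"
      by (simp add: mat_mult_eq_cscale adjoint_mult adjoint_E matrix_mul_assoc)
    then show ?thesis
      unfolding diff using gam_hat_identity[OF adjoint_E] matrix_inv_mult(1)[OF \<open>invertible E\<close>] by simp
  qed
  have negative: "phi D \<alpha> (\<Lambda> 0) = phi_hat E \<alpha> (\<Lambda> 0) \<and> gam D \<alpha> (\<Lambda> 0) = gam_hat E \<alpha> (\<Lambda> 0)
      \<and> (\<forall>S \<psi>. weyl_function H w S \<psi> \<longrightarrow> (\<forall>z \<in> \<complex>\<^sub>+ - S. \<psi> z = phi_hat E \<alpha> (\<Lambda> 0) z))"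
    if "negative_definite D"
  proof -
    have d: "d i < 0" for i
      using that negative_definite_diag_matrix D by blast
    then have "E = - D"
      unfolding minus_D E by (simp add: abs_of_neg)
    moreover have "\<psi> z = phi_hat E \<alpha> (\<Lambda> 0) z" if "weyl_function H w X \<psi>" "z \<in> \<complex>\<^sub>+ - X" for X \<psi> z
    proof (rule weyl_matrix_unique[OF d])
      show "Im z > 0"
        using that(2) by (simp add: upper_half_plane_def)
      show "energy_density (\<lambda>x. w x z ** above (mat 1) (- \<i> \<odot> \<psi> z)) integrable_on {0..}"
        using that unfolding weyl_function_def weyl_integrable_iff by blast
      show "energy_density (\<lambda>x. w x z ** above (mat 1) (- \<i> \<odot> phi_hat E \<alpha> (\<Lambda> 0) z)) integrable_on {0..}"
        using weyl_phi_hat that(2) unfolding weyl_function_def weyl_integrable_iff by blast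
    qed
    ultimately show ?thesis
      using phi_eq_phi_hat gam_eq_gam_hat by metis
  qed
  have holo: "\<forall>i j. (\<lambda>z. phi_hat E \<alpha> (\<Lambda> 0) z $ i $ j) holomorphic_on \<complex>\<^sub>+"
    using weyl_phi_hat by (simp add: weyl_function_def)
  have negative_phi: "phi D \<alpha> (\<Lambda> 0) = phi_hat E \<alpha> (\<Lambda> 0) \<and> weyl_function H w {} (phi D \<alpha> (\<Lambda> 0))
      \<and> (\<forall>S \<psi>. weyl_function H w S \<psi> \<longrightarrow> (\<forall>z \<in> \<complex>\<^sub>+ - S. \<psi> z = phi D \<alpha> (\<Lambda> 0) z))"
    if "negative_definite D"
    unfolding negative[OF that, THEN conjunct1] using weyl_phi_hat negative[OF that] by blast
  have negative_gam: "matrix_spectrum (gam D \<alpha> (\<Lambda> 0)) \<inter> \<complex>\<^sub>+ = {}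
      \<and> (\<forall>i j. (\<lambda>z. phi D \<alpha> (\<Lambda> 0) z $ i $ j) holomorphic_on \<complex>\<^sub>+)"
    if "negative_definite D"
    using no_spectrum holo by (simp only: negative[OF that] simp_thms)
  have Psi2: "\<forall>x\<ge>0. Psi2 D (\<Lambda> x) = Psi2 D (\<Lambda> 0)"
    using Psi2_constant by blast
  show ?thesis
    by (intro conjI impI) (fact Psi1_blocks Psi2 weyl_phi weyl_phi_hat gam gam_hat | use negative_phi negative_gam in blast)+
qed

end
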